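(* Let $\mathcal{C}$ be a spherical fusion category over $\mathbb{C}$, let $a\in\mathcal{C}$ be an object, let $b\in\mathrm{Irr}(Z(\mathcal{C}))$ be a simple object of the Drinfel'd center with twist scalar $\theta_b$, and let $n\geq 1$ be an integer. Then every eigenvalue of the generalized rotation operator $\rho^{b}_{n,a}:\mathrm{Hom}_{\mathcal{C}}(b,a^{\otimes n})\to \mathrm{Hom}_{\mathcal{C}}(b,a^{\otimes n})$ is an $n$-th root of $\theta_b^{-1}$. Moreover, for every $\omega\in\mathbb{C}$ with $\omega^n=\theta_b^{-1}$, the multiplicity of $\omega$ as an eigenvalue of $\rho^b_{n,a}$ equals $P^{b}_{n,a}(\omega^{-1})$, where $$P^{b}_{n,a}(x):=\sum_{k=0}^{n-1}\frac{\nu^{b}_{n,k}(a)}{n}\,x^{k},$$ and $\nu^b_{n,k}(a)=\mathrm{Tr}\big((\rho^b_{n,a})^k\big)$ are the generalized Frobenius-Schur indicators.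
   Context: A fusion category is a finite semisimple rigid $\mathbb{C}$-linear monoidal category with finite-dimensional Hom spaces, finitely many simple objects up to isomorphism and simple unit $\mathbb{1}$ with $\mathrm{End}(\mathbb{1})=\mathbb{C}$. It is taken to be strict and strictly pivotal: each object $a$ has a dual $\overline a$, with $\overline{\overline a}=a$, and morphisms $\mathrm{ev}_a:\overline a\otimes a\to\mathbb{1}$, $\mathrm{coev}_a:\mathbb{1}\to a\otimes\overline a$, $\mathrm{ev}_{\overline a}: a\otimes\overline a\to\mathbb{1}$, $\mathrm{coev}_{\overline a}:\mathbb{1}\to\overline a\otimes a$ satisfying the zig-zag equations for both dualities. It is spherical if the left and right traces of every endomorphism $f:a\to a$, namely $\mathrm{ev}_a\circ(1_{\overline a}\otimes f)\circ\mathrm{coev}_{\overline a}$ and $\mathrm{ev}_{\overline a}\circ(f\otimes 1_{\overline a})\circ\mathrm{coev}_a$, agree. The Drinfel'd center $Z(\mathcal{C})$ has as objects pairs $(b,e_{b,\cdot})$ with $b\in\mathcal{C}$ and $e_{b,x}:b\otimes x\to x\otimes b$ a half-braiding (natural in $x$, with $e_{b,x\otimes y}=(1_x\otimes e_{b,y})(e_{b,x}\otimes 1_y)$); it is a ribbon fusion category with braiding $e_{b,b'}:b\otimes b'\to b'\otimes b$, and twist $\theta_b=(1_b\otimes\mathrm{ev}_{\overline b})\circ(e_{b,b}\otimes 1_{\overline b})\circ(1_b\otimes\mathrm{coev}_b)$, which for simple $b$ is identified with a scalar. $\mathrm{Irr}$ denotes a set of representatives of simple objects. In $\mathrm{Hom}_{\mathcal{C}}(b,\cdot)$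 the object $b\in Z(\mathcal{C})$ is viewed in $\mathcal{C}$ by forgetting the half-braiding. For $a\in\mathcal{C}$, $b\in Z(\mathcal{C})$, $n\ge1$, the generalized rotation operator on $\mathrm{Hom}_{\mathcal{C}}(b,a^{\otimes n})$ is $$\rho^b_{n,a}(f)=(\mathrm{ev}_a\otimes 1_{a^{\otimes n}})\circ(1_{\overline a}\otimes f\otimes 1_a)\circ(e_{b,\overline a}\otimes 1_a)\circ(1_b\otimes\mathrm{coev}_{\overline a}).$$ For $k\in\mathbb{Z}$, $\nu^b_{n,k}(a):=\mathrm{Tr}((\rho^b_{n,a})^k)$, where $\mathrm{Tr}$ is the ordinary trace of a linear map. *)

theory Defs
  imports Complex_Main
begin

section \<open>Linear operators on subspaces\<close>

text \<open>
  Here \<open>V\<close> is a finite-dimensional subspace of the vector space with scalar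
  multiplication \<open>s\<close>, and \<open>T\<close> is a map whose restriction to \<open>V\<close> is a linear
  endomorphism of \<open>V\<close>.
\<close>

definition basis_of :: "('a::field \<Rightarrow> 'v::ab_group_add \<Rightarrow> 'v) \<Rightarrow> 'v set \<Rightarrow> 'v set \<Rightarrow> bool" where
  "basis_of s V B \<longleftrightarrow> B \<subseteq> V \<and> \<not> module.dependent s B \<and> module.span s B = V"

definition lin_trace :: "('a::field \<Rightarrow> 'v::ab_group_add \<Rightarrow> 'v) \<Rightarrow> 'v set \<Rightarrow> ('v \<Rightarrow> 'v) \<Rightarrow> 'a" where
  "lin_trace s V T =
     (let B = (SOME B. basis_of s V B) in \<Sum>v\<in>B. module.representation s B (T v) v)"

definition eigenvalue_on ::
    "('a::field \<Rightarrow> 'v::ab_group_add \<Rightarrow> 'v) \<Rightarrow> 'v set \<Rightarrow> ('v \<Rightarrow> 'v) \<Rightarrow> 'a \<Rightarrow> bool" where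
  "eigenvalue_on s V T c \<longleftrightarrow> (\<exists>v\<in>V. v \<noteq> 0 \<and> T v = s c v)"

definition geom_mult ::
    "('a::field \<Rightarrow> 'v::ab_group_add \<Rightarrow> 'v) \<Rightarrow> 'v set \<Rightarrow> ('v \<Rightarrow> 'v) \<Rightarrow> 'a \<Rightarrow> nat" where
  "geom_mult s V T c = vector_space.dim s {v \<in> V. T v = s c v}"

definition alg_mult ::
    "('a::field \<Rightarrow> 'v::ab_group_add \<Rightarrow> 'v) \<Rightarrow> 'v set \<Rightarrow> ('v \<Rightarrow> 'v) \<Rightarrow> 'a \<Rightarrow> nat" where
  "alg_mult s V T c =
     vector_space.dim s {v \<in> V. \<exists>m. ((\<lambda>u. T u - s c u) ^^ m) v = 0}"


section \<open>Complex-linear categories\<close>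

text \<open>
  All Hom spaces are subspaces of one ambient vector space \<open>'m\<close>, for instance the
  direct sum of all of them. They need not be disjoint (they share \<open>0\<close>), so a
  morphism does not determine its source and target, and every notion below names
  them. For the direct sum, composition and tensor product extend bilinearly to
  all of \<open>'m\<close>, so they can be untyped operations without loss of generality.
\<close>

record ('o, 'm) lin_cat =
  obj :: "'o set"
  hom :: "'o \<Rightarrow> 'o \<Rightarrow> 'm set"
  smult :: "complex \<Rightarrow> 'm \<Rightarrow> 'm"
  comp :: "'m \<Rightarrow> 'm \<Rightarrow> 'm"  (infixl \<open>\<cdot>\<index>\<close> 70)
  ident :: "'o \<Rightarrow> 'm"  (\<open>\<i>\<d>\<index>\<close>)

locale linear_category = vector_space "smult C"
  for C :: "('o, 'm::ab_group_add, 'z) lin_cat_scheme" (structure) +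
  assumes hom_subspace: "\<lbrakk>x \<in> obj C; y \<in> obj C\<rbrakk> \<Longrightarrow> subspace (hom C x y)"
    and ident_hom: "x \<in> obj C \<Longrightarrow> \<i>\<d> x \<in> hom C x x"
    and comp_hom: "\<lbrakk>x \<in> obj C; y \<in> obj C; z \<in> obj C; f \<in> hom C x y; g \<in> hom C y z\<rbrakk>
      \<Longrightarrow> g \<cdot> f \<in> hom C x z"
    and comp_assoc: "\<lbrakk>w \<in> obj C; x \<in> obj C; y \<in> obj C; z \<in> obj C;
        f \<in> hom C w x; g \<in> hom C x y; h \<in> hom C y z\<rbrakk> \<Longrightarrow> (h \<cdot> g) \<cdot> f = h \<cdot> (g \<cdot> f)"
    and ident_left: "\<lbrakk>x \<in> obj C; y \<in> obj C; f \<in> hom C x y\<rbrakk> \<Longrightarrow> \<i>\<d> y \<cdot> f = f"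
    and ident_right: "\<lbrakk>x \<in> obj C; y \<in> obj C; f \<in> hom C x y\<rbrakk> \<Longrightarrow> f \<cdot> \<i>\<d> x = f"
    and comp_add_left: "\<lbrakk>x \<in> obj C; y \<in> obj C; z \<in> obj C;
        f \<in> hom C x y; g \<in> hom C y z; h \<in> hom C y z\<rbrakk> \<Longrightarrow> (g + h) \<cdot> f = g \<cdot> f + h \<cdot> f"
    and comp_add_right: "\<lbrakk>x \<in> obj C; y \<in> obj C; z \<in> obj C;
        f \<in> hom C x y; g \<in> hom C x y; h \<in> hom C y z\<rbrakk> \<Longrightarrow> h \<cdot> (f + g) = h \<cdot> f + h \<cdot> g"
    and comp_smult_left: "\<lbrakk>x \<in> obj C; y \<in> obj C; z \<in> obj C;
        f \<in> hom C x y; g \<in> hom C y z\<rbrakk> \<Longrightarrow> smult C c g \<cdot> f = smult C c (g \<cdot> f)"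
    and comp_smult_right: "\<lbrakk>x \<in> obj C; y \<in> obj C; z \<in> obj C;
        f \<in> hom C x y; g \<in> hom C y z\<rbrakk> \<Longrightarrow> g \<cdot> smult C c f = smult C c (g \<cdot> f)"

context
  fixes C :: "('o, 'm::ab_group_add, 'z) lin_cat_scheme" (structure)
begin

definition is_iso :: "'o \<Rightarrow> 'o \<Rightarrow> 'm \<Rightarrow> bool" where
  "is_iso x y f \<longleftrightarrow> f \<in> hom C x y \<and> (\<exists>g\<in>hom C y x. g \<cdot> f = \<i>\<d> x \<and> f \<cdot> g = \<i>\<d> y)"

definition is_mono :: "'o \<Rightarrow> 'o \<Rightarrow> 'm \<Rightarrow> bool" where
  "is_mono x y f \<longleftrightarrow> f \<in> hom C x y \<and>
     (\<forall>w\<in>obj C. \<forall>g\<in>hom C w x. \<forall>h\<in>hom C w x. f \<cdot> g = f \<cdot> h \<longrightarrow> g = h)"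

definition is_epi :: "'o \<Rightarrow> 'o \<Rightarrow> 'm \<Rightarrow> bool" where
  "is_epi x y f \<longleftrightarrow> f \<in> hom C x y \<and>
     (\<forall>z\<in>obj C. \<forall>g\<in>hom C y z. \<forall>h\<in>hom C y z. g \<cdot> f = h \<cdot> f \<longrightarrow> g = h)"

definition is_kernel :: "'o \<Rightarrow> 'o \<Rightarrow> 'o \<Rightarrow> 'm \<Rightarrow> 'm \<Rightarrow> bool" where
  "is_kernel w x y k f \<longleftrightarrow> k \<in> hom C w x \<and> f \<in> hom C x y \<and> f \<cdot> k = 0 \<and>
     (\<forall>v\<in>obj C. \<forall>g\<in>hom C v x. f \<cdot> g = 0 \<longrightarrow> (\<exists>!h. h \<in> hom C v w \<and> k \<cdot> h = g))"

definition is_cokernel :: "'o \<Rightarrow> 'o \<Rightarrow> 'o \<Rightarrow> 'm \<Rightarrow> 'm \<Rightarrow> bool" where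
  "is_cokernel x y z q f \<longleftrightarrow> q \<in> hom C y z \<and> f \<in> hom C x y \<and> q \<cdot> f = 0 \<and>
     (\<forall>v\<in>obj C. \<forall>g\<in>hom C y v. g \<cdot> f = 0 \<longrightarrow> (\<exists>!h. h \<in> hom C z v \<and> h \<cdot> q = g))"

text \<open>\<open>x\<close> is nonzero, and its only subobjects are \<open>0\<close> and \<open>x\<close>.\<close>

definition simple_obj :: "'o \<Rightarrow> bool" where
  "simple_obj x \<longleftrightarrow> x \<in> obj C \<and> \<i>\<d> x \<noteq> 0 \<and>
     (\<forall>w\<in>obj C. \<forall>f. is_mono w x f \<longrightarrow> f = 0 \<or> is_iso w x f)"

definition direct_sum :: "'o \<Rightarrow> nat \<Rightarrow> (nat \<Rightarrow> 'o) \<Rightarrow> bool" where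
  "direct_sum x n s \<longleftrightarrow>
     (\<exists>i p. (\<forall>k<n. i k \<in> hom C (s k) x \<and> p k \<in> hom C x (s k)) \<and>
        (\<forall>j<n. \<forall>k<n. p j \<cdot> i k = (if j = k then \<i>\<d> (s k) else 0)) \<and>
        (\<Sum>k<n. i k \<cdot> p k) = \<i>\<d> x)"

end

text \<open>The empty direct sum is a zero object.\<close>

locale abelian_linear_category = linear_category +
  assumes direct_sums: "(\<And>k. k < n \<Longrightarrow> s k \<in> obj C) \<Longrightarrow> \<exists>x\<in>obj C. direct_sum C x n s"
    and kernels: "\<lbrakk>x \<in> obj C; y \<in> obj C; f \<in> hom C x y\<rbrakk>
      \<Longrightarrow> \<exists>w\<in>obj C. \<exists>k. is_kernel C w x y k f"
    and cokernels: "\<lbrakk>x \<in> obj C; y \<in> obj C; f \<in> hom C x y\<rbrakk>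
      \<Longrightarrow> \<exists>z\<in>obj C. \<exists>q. is_cokernel C x y z q f"
    and mono_normal: "\<lbrakk>x \<in> obj C; y \<in> obj C; is_mono C x y f\<rbrakk>
      \<Longrightarrow> \<exists>z\<in>obj C. \<exists>g. is_kernel C x y z f g"
    and epi_normal: "\<lbrakk>x \<in> obj C; y \<in> obj C; is_epi C x y f\<rbrakk>
      \<Longrightarrow> \<exists>w\<in>obj C. \<exists>g. is_cokernel C w x y f g"

locale finite_semisimple_category = abelian_linear_category +
  assumes hom_finite_dim: "\<lbrakk>x \<in> obj C; y \<in> obj C\<rbrakk> \<Longrightarrow> \<exists>B. finite B \<and> hom C x y = span B"
    and semisimple: "x \<in> obj C \<Longrightarrow> \<exists>n s. (\<forall>k<n. simple_obj C (s k)) \<and> direct_sum C x n s"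
    and finitely_many_simples: "\<exists>S. finite S \<and> S \<subseteq> obj C \<and>
      (\<forall>x. simple_obj C x \<longrightarrow> (\<exists>y\<in>S. \<exists>f. is_iso C x y f))"


section \<open>Strict monoidal and strictly pivotal categories\<close>

record ('o, 'm) piv_cat = "('o, 'm) lin_cat" +
  tens :: "'o \<Rightarrow> 'o \<Rightarrow> 'o"  (infixr \<open>\<otimes>\<^sub>o\<index>\<close> 75)
  tens_hom :: "'m \<Rightarrow> 'm \<Rightarrow> 'm"  (infixr \<open>\<otimes>\<^sub>m\<index>\<close> 75)
  unit_obj :: "'o"  (\<open>\<one>\<^sub>o\<index>\<close>)
  dual :: "'o \<Rightarrow> 'o"
  ev :: "'o \<Rightarrow> 'm"
  coev :: "'o \<Rightarrow> 'm"

locale strict_monoidal_linear_category = linear_category C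
  for C :: "('o, 'm::ab_group_add, 'z) piv_cat_scheme" (structure) +
  assumes unit_obj: "\<one>\<^sub>o \<in> obj C"
    and tens_obj: "\<lbrakk>x \<in> obj C; y \<in> obj C\<rbrakk> \<Longrightarrow> x \<otimes>\<^sub>o y \<in> obj C"
    and tens_assoc: "\<lbrakk>x \<in> obj C; y \<in> obj C; z \<in> obj C\<rbrakk>
      \<Longrightarrow> (x \<otimes>\<^sub>o y) \<otimes>\<^sub>o z = x \<otimes>\<^sub>o (y \<otimes>\<^sub>o z)"
    and tens_unit_left: "x \<in> obj C \<Longrightarrow> \<one>\<^sub>o \<otimes>\<^sub>o x = x"
    and tens_unit_right: "x \<in> obj C \<Longrightarrow> x \<otimes>\<^sub>o \<one>\<^sub>o = x"
    and tens_hom: "\<lbrakk>x \<in> obj C; y \<in> obj C; x' \<in> obj C; y' \<in> obj C;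
        f \<in> hom C x y; g \<in> hom C x' y'\<rbrakk> \<Longrightarrow> f \<otimes>\<^sub>m g \<in> hom C (x \<otimes>\<^sub>o x') (y \<otimes>\<^sub>o y')"
    and tens_ident: "\<lbrakk>x \<in> obj C; y \<in> obj C\<rbrakk> \<Longrightarrow> \<i>\<d> x \<otimes>\<^sub>m \<i>\<d> y = \<i>\<d> (x \<otimes>\<^sub>o y)"
    and interchange: "\<lbrakk>x \<in> obj C; y \<in> obj C; z \<in> obj C; x' \<in> obj C; y' \<in> obj C; z' \<in> obj C;
        f \<in> hom C x y; g \<in> hom C y z; f' \<in> hom C x' y'; g' \<in> hom C y' z'\<rbrakk>
      \<Longrightarrow> (g \<otimes>\<^sub>m g') \<cdot> (f \<otimes>\<^sub>m f') = (g \<cdot> f) \<otimes>\<^sub>m (g' \<cdot> f')"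
    and tens_hom_assoc: "\<lbrakk>x \<in> obj C; x' \<in> obj C; y \<in> obj C; y' \<in> obj C; z \<in> obj C; z' \<in> obj C;
        f \<in> hom C x x'; g \<in> hom C y y'; h \<in> hom C z z'\<rbrakk>
      \<Longrightarrow> (f \<otimes>\<^sub>m g) \<otimes>\<^sub>m h = f \<otimes>\<^sub>m (g \<otimes>\<^sub>m h)"
    and tens_hom_unit_left: "\<lbrakk>x \<in> obj C; y \<in> obj C; f \<in> hom C x y\<rbrakk> \<Longrightarrow> \<i>\<d> \<one>\<^sub>o \<otimes>\<^sub>m f = f"
    and tens_hom_unit_right: "\<lbrakk>x \<in> obj C; y \<in> obj C; f \<in> hom C x y\<rbrakk> \<Longrightarrow> f \<otimes>\<^sub>m \<i>\<d> \<one>\<^sub>o = f"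
    and tens_add_left: "\<lbrakk>x \<in> obj C; y \<in> obj C; x' \<in> obj C; y' \<in> obj C;
        f \<in> hom C x y; g \<in> hom C x y; h \<in> hom C x' y'\<rbrakk>
      \<Longrightarrow> (f + g) \<otimes>\<^sub>m h = f \<otimes>\<^sub>m h + g \<otimes>\<^sub>m h"
    and tens_add_right: "\<lbrakk>x \<in> obj C; y \<in> obj C; x' \<in> obj C; y' \<in> obj C;
        f \<in> hom C x y; g \<in> hom C x' y'; h \<in> hom C x' y'\<rbrakk>
      \<Longrightarrow> f \<otimes>\<^sub>m (g + h) = f \<otimes>\<^sub>m g + f \<otimes>\<^sub>m h"
    and tens_smult_left: "\<lbrakk>x \<in> obj C; y \<in> obj C; x' \<in> obj C; y' \<in> obj C;
        f \<in> hom C x y; g \<in> hom C x' y'\<rbrakk> \<Longrightarrow> smult C c f \<otimes>\<^sub>m g = smult C c (f \<otimes>\<^sub>m g)"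
    and tens_smult_right: "\<lbrakk>x \<in> obj C; y \<in> obj C; x' \<in> obj C; y' \<in> obj C;
        f \<in> hom C x y; g \<in> hom C x' y'\<rbrakk> \<Longrightarrow> f \<otimes>\<^sub>m smult C c g = smult C c (f \<otimes>\<^sub>m g)"

text \<open>
  Since the bidual of \<open>a\<close> equals \<open>a\<close>, the family \<open>ev\<close> has the components
  \<open>ev a : dual a \<otimes> a \<rightarrow> 1\<close> and \<open>ev (dual a) : a \<otimes> dual a \<rightarrow> 1\<close>, and the zig-zag
  equations for all objects cover both dualities. The last assumptions say that the
  pivotal structure, the identity \<open>a \<rightarrow> dual (dual a)\<close>, is monoidal
  (compatibility with \<open>\<otimes>\<close> and \<open>1\<close>) and natural (the left and right duals of a
  morphism agree).
\<close>

locale strict_pivotal_linear_category = strict_monoidal_linear_category +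
  assumes dual_obj: "a \<in> obj C \<Longrightarrow> dual C a \<in> obj C"
    and dual_dual: "a \<in> obj C \<Longrightarrow> dual C (dual C a) = a"
    and ev_hom: "a \<in> obj C \<Longrightarrow> ev C a \<in> hom C (dual C a \<otimes>\<^sub>o a) \<one>\<^sub>o"
    and coev_hom: "a \<in> obj C \<Longrightarrow> coev C a \<in> hom C \<one>\<^sub>o (a \<otimes>\<^sub>o dual C a)"
    and zigzag: "a \<in> obj C \<Longrightarrow> (\<i>\<d> a \<otimes>\<^sub>m ev C a) \<cdot> (coev C a \<otimes>\<^sub>m \<i>\<d> a) = \<i>\<d> a"
    and zigzag_dual: "a \<in> obj C \<Longrightarrow>
      (ev C a \<otimes>\<^sub>m \<i>\<d> (dual C a)) \<cdot> (\<i>\<d> (dual C a) \<otimes>\<^sub>m coev C a) = \<i>\<d> (dual C a)"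
    and dual_unit: "dual C \<one>\<^sub>o = \<one>\<^sub>o"
    and ev_unit: "ev C \<one>\<^sub>o = \<i>\<d> \<one>\<^sub>o"
    and coev_unit: "coev C \<one>\<^sub>o = \<i>\<d> \<one>\<^sub>o"
    and dual_tens: "\<lbrakk>a \<in> obj C; b \<in> obj C\<rbrakk> \<Longrightarrow> dual C (a \<otimes>\<^sub>o b) = dual C b \<otimes>\<^sub>o dual C a"
    and ev_tens: "\<lbrakk>a \<in> obj C; b \<in> obj C\<rbrakk> \<Longrightarrow>
      ev C (a \<otimes>\<^sub>o b) = ev C b \<cdot> (\<i>\<d> (dual C b) \<otimes>\<^sub>m ev C a \<otimes>\<^sub>m \<i>\<d> b)"
    and coev_tens: "\<lbrakk>a \<in> obj C; b \<in> obj C\<rbrakk> \<Longrightarrow>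
      coev C (a \<otimes>\<^sub>o b) = (\<i>\<d> a \<otimes>\<^sub>m coev C b \<otimes>\<^sub>m \<i>\<d> (dual C a)) \<cdot> coev C a"
    and dual_morphisms: "\<lbrakk>a \<in> obj C; b \<in> obj C; f \<in> hom C a b\<rbrakk> \<Longrightarrow>
      (ev C b \<otimes>\<^sub>m \<i>\<d> (dual C a)) \<cdot> (\<i>\<d> (dual C b) \<otimes>\<^sub>m f \<otimes>\<^sub>m \<i>\<d> (dual C a))
          \<cdot> (\<i>\<d> (dual C b) \<otimes>\<^sub>m coev C a)
      = (\<i>\<d> (dual C a) \<otimes>\<^sub>m ev C (dual C b)) \<cdot> (\<i>\<d> (dual C a) \<otimes>\<^sub>m f \<otimes>\<^sub>m \<i>\<d> (dual C b))
          \<cdot> (coev C (dual C a) \<otimes>\<^sub>m \<i>\<d> (dual C b))"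

locale pivotal_fusion_category =
  strict_pivotal_linear_category C + finite_semisimple_category C
  for C :: "('o, 'm::ab_group_add, 'z) piv_cat_scheme" (structure) +
  assumes unit_simple: "simple_obj C \<one>\<^sub>o"
    and unit_End: "hom C \<one>\<^sub>o \<one>\<^sub>o = range (\<lambda>c. smult C c (\<i>\<d> \<one>\<^sub>o))"

locale spherical_fusion_category = pivotal_fusion_category +
  assumes spherical: "\<lbrakk>a \<in> obj C; f \<in> hom C a a\<rbrakk> \<Longrightarrow>
    ev C a \<cdot> (\<i>\<d> (dual C a) \<otimes>\<^sub>m f) \<cdot> coev C (dual C a)
    = ev C (dual C a) \<cdot> (f \<otimes>\<^sub>m \<i>\<d> (dual C a)) \<cdot> coev C a"


section \<open>Drinfeld center, rotation operators and indicators\<close>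

context
  fixes C :: "('o, 'm::ab_group_add, 'z) piv_cat_scheme" (structure)
begin

definition half_braiding :: "'o \<Rightarrow> ('o \<Rightarrow> 'm) \<Rightarrow> bool" where
  "half_braiding b e \<longleftrightarrow>
     (\<forall>x\<in>obj C. is_iso C (b \<otimes>\<^sub>o x) (x \<otimes>\<^sub>o b) (e x)) \<and>
     (\<forall>x\<in>obj C. \<forall>y\<in>obj C. \<forall>f\<in>hom C x y. (f \<otimes>\<^sub>m \<i>\<d> b) \<cdot> e x = e y \<cdot> (\<i>\<d> b \<otimes>\<^sub>m f)) \<and>
     (\<forall>x\<in>obj C. \<forall>y\<in>obj C. e (x \<otimes>\<^sub>o y) = (\<i>\<d> x \<otimes>\<^sub>m e y) \<cdot> (e x \<otimes>\<^sub>m \<i>\<d> y))"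

definition center :: "('o \<times> ('o \<Rightarrow> 'm), 'm) lin_cat" where
  "center = \<lparr>
     obj = {(b, e). b \<in> obj C \<and> half_braiding b e},
     hom = (\<lambda>(b, e) (b', e'). {f \<in> hom C b b'.
              \<forall>x\<in>obj C. (\<i>\<d> x \<otimes>\<^sub>m f) \<cdot> e x = e' x \<cdot> (f \<otimes>\<^sub>m \<i>\<d> x)}),
     smult = smult C,
     comp = comp C,
     ident = (\<lambda>(b, e). \<i>\<d> b)\<rparr>"

fun twist :: "'o \<times> ('o \<Rightarrow> 'm) \<Rightarrow> 'm" where
  "twist (b, e) =
     (\<i>\<d> b \<otimes>\<^sub>m ev C (dual C b)) \<cdot> (e b \<otimes>\<^sub>m \<i>\<d> (dual C b)) \<cdot> (\<i>\<d> b \<otimes>\<^sub>m coev C b)"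

text \<open>Only meaningful for simple objects of the center, on which the twist is a scalar.\<close>

definition twist_scalar :: "'o \<times> ('o \<Rightarrow> 'm) \<Rightarrow> complex" where
  "twist_scalar b = (THE c. twist b = smult C c (\<i>\<d> (fst b)))"

primrec tens_pow :: "'o \<Rightarrow> nat \<Rightarrow> 'o" where
  "tens_pow a 0 = \<one>\<^sub>o"
| "tens_pow a (Suc n) = a \<otimes>\<^sub>o tens_pow a n"

abbreviation rot_space :: "'o \<times> ('o \<Rightarrow> 'm) \<Rightarrow> nat \<Rightarrow> 'o \<Rightarrow> 'm set" where
  "rot_space b n a \<equiv> hom C (fst b) (tens_pow a n)"

fun rot :: "'o \<times> ('o \<Rightarrow> 'm) \<Rightarrow> nat \<Rightarrow> 'o \<Rightarrow> 'm \<Rightarrow> 'm" where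
  "rot (b, e) n a f =
     (ev C a \<otimes>\<^sub>m \<i>\<d> (tens_pow a n)) \<cdot> (\<i>\<d> (dual C a) \<otimes>\<^sub>m f \<otimes>\<^sub>m \<i>\<d> a)
       \<cdot> (e (dual C a) \<otimes>\<^sub>m \<i>\<d> a) \<cdot> (\<i>\<d> b \<otimes>\<^sub>m coev C (dual C a))"

definition rot_power :: "'o \<times> ('o \<Rightarrow> 'm) \<Rightarrow> nat \<Rightarrow> 'o \<Rightarrow> int \<Rightarrow> 'm \<Rightarrow> 'm" where
  "rot_power b n a k =
     (if 0 \<le> k then rot b n a ^^ nat k
      else inv_into (rot_space b n a) (rot b n a) ^^ nat (- k))"

definition FS_indicator :: "'o \<times> ('o \<Rightarrow> 'm) \<Rightarrow> nat \<Rightarrow> int \<Rightarrow> 'o \<Rightarrow> complex" where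
  "FS_indicator b n k a = lin_trace (smult C) (rot_space b n a) (rot_power b n a k)"

definition FS_poly :: "'o \<times> ('o \<Rightarrow> 'm) \<Rightarrow> nat \<Rightarrow> 'o \<Rightarrow> complex \<Rightarrow> complex" where
  "FS_poly b n a x = (\<Sum>k<n. FS_indicator b n (int k) a / of_nat n * x ^ k)"

end

end

theory Submission
  imports Defs "HOL-Computational_Algebra.Fundamental_Theorem_Algebra"
begin

text \<open>
  For a morphism \<open>S : b \<rightarrow> x \<otimes> y\<close> write \<open>rotate x y S : b \<rightarrow> y \<otimes> x\<close> for the rotation of the factor \<open>x\<close>
  around \<open>b\<close>. It is the unique \<open>G\<close> such that bending the leg \<open>x\<close> of \<open>S\<close> down on the left and
  precomposing with the half-braiding equals bending the leg \<open>x\<close> of \<open>G\<close> down on the right. From this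
  description rotations compose, \<open>rotate (x \<otimes> x') = rotate x' \<circ> rotate x\<close>, so the \<open>n\<close>-th power of the
  rotation operator is the full rotation of \<open>a\<^sup>n\<close>, and pivotality shows that full rotation
  undoes precomposition with the twist. The twist is a morphism of the center, hence a scalar \<open>\<theta>\<close> by
  Schur's lemma, and the rotation operator \<open>T\<close> satisfies \<open>T\<^sup>n = \<theta>\<^sup>-\<^sup>1\<close>. It is therefore diagonalizable,
  and for \<open>\<omega>\<^sup>n = \<theta>\<^sup>-\<^sup>1\<close> the projection onto the \<open>\<omega>\<close>-eigenspace is the average of \<open>\<omega>\<^sup>-\<^sup>k T\<^sup>k\<close> over
  \<open>0 \<le> k < n\<close>, whose trace is the multiplicity.
\<close>

section \<open>Operators with a scalar power\<close>

locale finite_dim_subspace = vector_space scale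
  for scale :: "'a::field \<Rightarrow> 'b::ab_group_add \<Rightarrow> 'b" +
  fixes V :: "'b set"
  assumes finite_span: "\<exists>F. finite F \<and> V = span F"
begin

lemma subspace_V: "subspace V"
  using finite_span by auto

text \<open>Linearity is asked on \<open>V\<close> only: the rotation operator is built from untyped
  operations that are bilinear only on named Hom spaces.\<close>

definition endo :: "('b \<Rightarrow> 'b) \<Rightarrow> bool" where
  "endo T \<longleftrightarrow> (\<forall>v\<in>V. T v \<in> V) \<and> (\<forall>u\<in>V. \<forall>v\<in>V. T (u + v) = T u + T v)
    \<and> (\<forall>c. \<forall>v\<in>V. T (scale c v) = scale c (T v))"

lemma endo_zero: "endo T \<Longrightarrow> T 0 = 0"
  using subspace_0[OF subspace_V] scale_zero_left unfolding endo_def by metis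

lemma endo_sum:
  assumes "endo T" "\<And>i. i \<in> A \<Longrightarrow> f i \<in> V"
  shows "T (\<Sum>i\<in>A. scale (c i) (f i)) = (\<Sum>i\<in>A. scale (c i) (T (f i)))"
  using assms(2)
proof (induction A rule: infinite_finite_induct)
  case (insert x A)
  then have "(\<Sum>i\<in>A. scale (c i) (f i)) \<in> V"
    using subspace_V by (intro subspace_sum subspace_scale) auto
  then show ?case
    using insert assms(1) subspace_scale[OF subspace_V] by (simp add: endo_def)
qed (use endo_zero assms in auto)

lemma endo_funpow: "endo T \<Longrightarrow> endo (T ^^ k)"
  by (induction k) (auto simp: endo_def)

section \<open>Bases and traces\<close>

lemma basis_of_unfold: "basis_of scale V B \<longleftrightarrow> B \<subseteq> V \<and> independent B \<and> span B = V"
  by (simp add: basis_of_def)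

lemma basis_of_finite: "basis_of scale V B \<Longrightarrow> finite B"
  using finite_span independent_span_bound[of _ B] by (auto simp: basis_of_unfold)

lemma basis_of_exists: "\<exists>B. basis_of scale V B"
proof -
  obtain B where "B \<subseteq> V" "independent B" "V \<subseteq> span B"
    using maximal_independent_subset[of V] by blast
  then show ?thesis using span_minimal[OF _ subspace_V, of B] by (auto simp: basis_of_unfold)
qed

text \<open>Makes the basis chosen by \<open>SOME\<close> in \<open>lin_trace\<close> immaterial.
  Expanding \<open>v\<close> in \<open>B'\<close> and \<open>T u\<close> in \<open>B\<close> turns
  both traces into one double sum.\<close>

lemma trace_basis_change:
  assumes "basis_of scale V B" "basis_of scale V B'" "endo T"
  shows "(\<Sum>v\<in>B. representation B (T v) v) = (\<Sum>v\<in>B'. representation B' (T v) v)"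
proof -
  have B: "independent B" "span B = V" "B \<subseteq> V" and B': "independent B'" "span B' = V" "B' \<subseteq> V"
    using assms by (auto simp: basis_of_unfold)
  have fin: "finite B" "finite B'" using assms basis_of_finite by blast+
  have TV: "v \<in> V \<Longrightarrow> T v \<in> V" for v using assms by (auto simp: endo_def)
  have sT: "scale c (T u) \<in> span B" if "u \<in> B'" for c u
    using that TV B(2) B'(3) by (auto intro: span_scale)
  have 1: "representation B (T v) v = (\<Sum>u\<in>B'. representation B' v u * representation B (T u) v)"
    if "v \<in> B" for v
  proof -
    have "v = (\<Sum>u\<in>B'. scale (representation B' v u) u)"
      using sum_representation_eq[of B' v B'] B' B that fin by auto
    then have "T v = (\<Sum>u\<in>B'. scale (representation B' v u) (T u))"
      using endo_sum[OF assms(3), of B' "\<lambda>u. u" "representation B' v"] B'(3) by auto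
    also have "representation B \<dots> = (\<lambda>w. \<Sum>u\<in>B'. representation B (scale (representation B' v u) (T u)) w)"
      using B(1) sT by (intro representation_sum)
    finally have "representation B (T v) v = (\<Sum>u\<in>B'. representation B (scale (representation B' v u) (T u)) v)"
      by simp
    then show ?thesis using B B' TV by (simp add: representation_scale subset_iff)
  qed
  have 2: "representation B' (T u) u = (\<Sum>v\<in>B. representation B (T u) v * representation B' v u)"
    if "u \<in> B'" for u
  proof -
    have "T u = (\<Sum>v\<in>B. scale (representation B (T u) v) v)"
      using sum_representation_eq[of B "T u" B] B B' that TV fin by auto
    also have "representation B' \<dots> = (\<lambda>w. \<Sum>v\<in>B. representation B' (scale (representation B (T u) v) v) w)"
      using B(3) B'(1,2) by (intro representation_sum) (auto intro: span_scale)
    finally have "representation B' (T u) u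
        = (\<Sum>v\<in>B. representation B' (scale (representation B (T u) v) v) u)"
      by simp
    then show ?thesis using B B' by (simp add: representation_scale subset_iff)
  qed
  show ?thesis by (simp add: 1 2 sum.swap[of _ B B'] mult.commute)
qed

text \<open>A basis \<open>D\<close> of \<open>E\<close> extends to a basis of \<open>V\<close>.
  There the members of \<open>D\<close> are fixed and contribute 1 each, while every other basis
  vector goes into \<open>span D\<close> and contributes 0 to the diagonal.\<close>

lemma trace_projection:
  assumes B: "basis_of scale V B" and P: "endo P"
    and E: "subspace E" "E \<subseteq> V" "\<And>v. v \<in> V \<Longrightarrow> P v \<in> E" "\<And>v. v \<in> E \<Longrightarrow> P v = v"
  shows "(\<Sum>v\<in>B. representation B (P v) v) = of_nat (dim E)"
proof -
  obtain D where D: "D \<subseteq> E" "independent D" "E \<subseteq> span D" "card D = dim E"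
    using basis_exists[of E] by blast
  have sD: "span D = E" using D E span_minimal[of D E] by auto
  obtain B' where B': "D \<subseteq> B'" "B' \<subseteq> V" "independent B'" "V \<subseteq> span B'"
    using maximal_independent_subset_extend[of D V] D E by (metis subset_trans)
  have bB': "basis_of scale V B'"
    using B' span_minimal[of B' V] subspace_V by (auto simp: basis_of_unfold)
  have fin: "finite B'" using basis_of_finite bB' by blast
  have "(\<Sum>v\<in>B. representation B (P v) v) = (\<Sum>v\<in>B'. representation B' (P v) v)"
    using trace_basis_change B bB' P by blast
  also have "\<dots> = (\<Sum>v\<in>B'. if v \<in> D then 1 else 0)"
  proof (rule sum.cong)
    fix v assume v: "v \<in> B'"
    show "representation B' (P v) v = (if v \<in> D then 1 else 0)"
    proof (cases "v \<in> D")
      case True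
      then show ?thesis using E(4) D(1) v B'(3) by (auto simp: representation_basis)
    next
      case False
      have "representation B' (P v) = representation D (P v)"
        using representation_extend[OF B'(3) _ B'(1), of "P v"] sD E(3) v B'(2) by blast
      then show ?thesis using False representation_ne_zero by force
    qed
  qed simp
  also have "\<dots> = of_nat (card D)"
    using fin B'(1) by (simp add: sum.If_cases Int_absorb1)
  finally show ?thesis using D by simp
qed

section \<open>Eigenspaces of an operator with a scalar power\<close>

text \<open>Rules out Jordan blocks. By induction the error \<open>u = T v - w v\<close> is an
  eigenvector; then \<open>(T ^^ n) v\<close> contains the off-diagonal term
  \<open>n * w ^ (n - 1)\<close> times \<open>u\<close>, which a scalar power forbids unless
  \<open>u = 0\<close>.\<close>

lemma finite_order_generalized_eigenvector:
  assumes T: "endo T" and Tn: "\<And>v. v \<in> V \<Longrightarrow> (T ^^ n) v = scale (w ^ n) v"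
    and "w \<noteq> 0" "of_nat n \<noteq> (0::'a)" and v: "v \<in> V" "((\<lambda>u. T u - scale w u) ^^ m) v = 0"
  shows "T v = scale w v"
  using v
proof (induction m arbitrary: v)
  case 0
  then show ?case using endo_zero[OF T] by simp
next
  case (Suc m)
  define u where "u = T v - scale w v"
  have u: "u \<in> V"
    unfolding u_def using T Suc.prems(1) subspace_diff[OF subspace_V] subspace_scale[OF subspace_V]
    by (auto simp: endo_def)
  have "((\<lambda>u. T u - scale w u) ^^ m) u = 0"
    using Suc.prems(2) by (simp add: funpow_Suc_right u_def del: funpow.simps)
  then have Tu: "T u = scale w u" using Suc.IH u by blast
  \<comment> \<open>Powers of a Jordan block of size two. At \<open>k = 0\<close> the factor
    \<open>of_nat k\<close> vanishes, so the truncated exponent \<open>k - 1\<close> is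
    harmless.\<close>
  have pow: "(T ^^ k) v = scale (w ^ k) v + scale (of_nat k * w ^ (k - 1)) u" for k
  proof (induction k)
    case (Suc k)
    have "(T ^^ Suc k) v = scale (w ^ k) (T v) + scale (of_nat k * w ^ (k - 1)) (T u)"
      using T u Suc.IH \<open>v \<in> V\<close> subspace_scale[OF subspace_V] by (simp add: endo_def)
    also have "T v = scale w v + u" by (simp add: u_def)
    also have "scale (w ^ k) (scale w v + u) + scale (of_nat k * w ^ (k - 1)) (T u)
       = scale (w ^ Suc k) v + scale (w ^ k + of_nat k * w ^ (k - 1) * w) u"
      by (simp add: Tu scale_right_distrib scale_left_distrib algebra_simps)
    also have "w ^ k + of_nat k * w ^ (k - 1) * w = of_nat (Suc k) * w ^ (Suc k - 1)"
      by (cases k) (simp_all add: algebra_simps)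
    finally show ?case .
  qed simp
  have "scale (of_nat n * w ^ (n - 1)) u = 0"
    using pow[of n] Tn[OF \<open>v \<in> V\<close>] by simp
  then have "u = 0" using assms(3,4) by simp
  then show ?case by (simp add: u_def)
qed

text \<open>Each summand is sent by \<open>T\<close> to \<open>w\<close> times the next one, so
  \<open>T\<close> shifts the sum cyclically; on an eigenvector for \<open>w\<close> all
  \<open>n\<close> summands equal \<open>v / n\<close>.\<close>

lemma finite_order_spectral_projection:
  assumes T: "endo T" and Tn: "\<And>v. v \<in> V \<Longrightarrow> (T ^^ n) v = scale (w ^ n) v"
    and w: "w \<noteq> 0" and n: "of_nat n \<noteq> (0::'a)"
  defines "P \<equiv> \<lambda>v. \<Sum>k<n. scale (inverse w ^ k / of_nat n) ((T ^^ k) v)"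
  shows "endo P"
    and "v \<in> V \<Longrightarrow> T (P v) = scale w (P v)"
    and "T v = scale w v \<Longrightarrow> v \<in> V \<Longrightarrow> P v = v"
proof -
  have Tk: "endo (T ^^ k)" for k using endo_funpow T by blast
  then have inV: "v \<in> V \<Longrightarrow> (T ^^ k) v \<in> V" for k v by (auto simp: endo_def)
  show "endo P"
    using Tk subspace_V unfolding endo_def P_def
    by (auto simp: scale_right_distrib sum.distrib scale_sum_right mult.commute
        intro!: subspace_sum subspace_scale)
  show "P v = v" if "T v = scale w v" "v \<in> V"
  proof -
    have "(T ^^ k) v = scale (w ^ k) v" for k
    proof (induction k)
      case (Suc k)
      then show ?case using that T by (simp add: endo_def mult.commute)
    qed simp
    then have "P v = (\<Sum>k<n. scale (1 / of_nat n) v)"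
      using w by (simp add: P_def flip: power_mult_distrib)
    also have "\<dots> = scale (\<Sum>k<n. 1 / of_nat n) v" by (simp only: scale_sum_left)
    finally show ?thesis using n by simp
  qed
  show "T (P v) = scale w (P v)" if "v \<in> V"
  proof -
    let ?f = "\<lambda>k. scale (inverse w ^ k / of_nat n) ((T ^^ k) v)"
    have "T (P v) = (\<Sum>k<n. scale (inverse w ^ k / of_nat n) (T ((T ^^ k) v)))"
      unfolding P_def
      using endo_sum[OF T, of "{..<n}" "\<lambda>k. (T ^^ k) v" "\<lambda>k. inverse w ^ k / of_nat n"] inV that
      by simp
    also have "\<dots> = (\<Sum>k<n. scale w (?f (Suc k)))"
    proof -
      have "w * (inverse w ^ Suc k / of_nat n) = inverse w ^ k / of_nat n" for k
        using w by simp
      then show ?thesis by (simp only: scale_scale funpow.simps comp_apply)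
    qed
    also have "\<dots> = scale w (\<Sum>k<n. ?f (Suc k))" by (simp only: scale_sum_right)
    \<comment> \<open>The cycle closes: \<open>T ^^ n\<close> acts as \<open>w ^ n\<close>, which
      the weight \<open>inverse w ^ n\<close> cancels, so the summand at \<open>n\<close> is the one
      at 0.\<close>
    also have "(\<Sum>k<n. ?f (Suc k)) = (\<Sum>k<n. ?f k)"
    proof -
      have "?f n = ?f 0" using Tn[OF that] w by (simp flip: power_mult_distrib)
      moreover have "?f 0 + (\<Sum>k<n. ?f (Suc k)) = (\<Sum>k<n. ?f k) + ?f n"
        using sum.lessThan_Suc_shift[of ?f n] sum.lessThan_Suc[of ?f n] by (simp only:)
      ultimately show ?thesis by (simp add: algebra_simps)
    qed
    finally show ?thesis by (simp add: P_def)
  qed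
qed

text \<open>The sum is the trace of the spectral projection, hence the dimension of its image. If
  \<open>w\<close> is not an eigenvalue, both sides are 0.\<close>

lemma finite_order_multiplicities:
  assumes T: "endo T" and Tn: "\<And>v. v \<in> V \<Longrightarrow> (T ^^ n) v = scale (w ^ n) v"
    and w: "w \<noteq> 0" and n: "of_nat n \<noteq> (0::'a)"
  shows "of_nat (geom_mult scale V T w)
      = (\<Sum>k<n. lin_trace scale V (T ^^ k) / of_nat n * inverse w ^ k)"
    and "alg_mult scale V T w = geom_mult scale V T w"
proof -
  define E where "E = {v \<in> V. T v = scale w v}"
  define P where "P = (\<lambda>v. \<Sum>k<n. scale (inverse w ^ k / of_nat n) ((T ^^ k) v))"
  have P: "endo P" "\<And>v. v \<in> V \<Longrightarrow> T (P v) = scale w (P v)"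
    "\<And>v. T v = scale w v \<Longrightarrow> v \<in> V \<Longrightarrow> P v = v"
    using finite_order_spectral_projection[OF T Tn w n] unfolding P_def by simp_all
  have sE: "subspace E"
    using subspace_V T endo_zero[OF T] unfolding E_def endo_def subspace_def
    by (auto simp: scale_right_distrib mult.commute)
  define B where "B = (SOME B. basis_of scale V B)"
  have B: "basis_of scale V B" unfolding B_def by (rule someI_ex[OF basis_of_exists])
  have sB: "independent B" "span B = V" "B \<subseteq> V" using B by (auto simp: basis_of_unfold)
  have Tk: "v \<in> V \<Longrightarrow> (T ^^ k) v \<in> V" for k v
    using endo_funpow[OF T] by (auto simp: endo_def)
  \<comment> \<open>\<open>lin_trace\<close> picks its basis from \<open>V\<close> alone, so all
    powers of \<open>T\<close> are traced in the same \<open>B\<close> and the sums can be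
    exchanged.\<close>
  have "(\<Sum>k<n. lin_trace scale V (T ^^ k) / of_nat n * inverse w ^ k)
      = (\<Sum>v\<in>B. \<Sum>k<n. inverse w ^ k / of_nat n * representation B ((T ^^ k) v) v)"
    by (simp add: lin_trace_def B_def[symmetric] Let_def sum_divide_distrib sum_distrib_left
        sum.swap[of _ B] mult.commute)
  also have "\<dots> = (\<Sum>v\<in>B. representation B (P v) v)"
  proof (rule sum.cong)
    fix v assume "v \<in> B"
    then show "(\<Sum>k<n. inverse w ^ k / of_nat n * representation B ((T ^^ k) v) v) = representation B (P v) v"
      unfolding P_def using Tk sB(3)
      by (subst representation_sum[OF sB(1)])
        (auto simp: representation_scale sB(1,2) subset_iff intro!: subspace_scale[OF subspace_V])
  qed simp
  also have "\<dots> = of_nat (dim E)"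
    using P sE by (intro trace_projection[OF B]) (auto simp: E_def endo_def)
  finally show "of_nat (geom_mult scale V T w)
      = (\<Sum>k<n. lin_trace scale V (T ^^ k) / of_nat n * inverse w ^ k)"
    by (simp add: geom_mult_def E_def)
  have "{v \<in> V. \<exists>m. ((\<lambda>u. T u - scale w u) ^^ m) v = 0} = E"
    using finite_order_generalized_eigenvector[OF T Tn w n]
    by (auto simp: E_def intro: exI[of _ 1])
  then show "alg_mult scale V T w = geom_mult scale V T w"
    by (simp add: alg_mult_def geom_mult_def E_def)
qed

section \<open>Polynomials in an operator and existence of eigenvectors\<close>

definition poly_act :: "('b \<Rightarrow> 'b) \<Rightarrow> 'a poly \<Rightarrow> 'b \<Rightarrow> 'b" where
  "poly_act T p v = (\<Sum>i\<le>degree p. scale (coeff p i) ((T ^^ i) v))"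

lemma poly_act_bound:
  "degree p \<le> N \<Longrightarrow> poly_act T p v = (\<Sum>i\<le>N. scale (coeff p i) ((T ^^ i) v))"
  unfolding poly_act_def by (rule sum.mono_neutral_left) (auto simp: coeff_eq_0)

lemma poly_act_add: "poly_act T (p + q) v = poly_act T p v + poly_act T q v"
  using poly_act_bound[of p "max (degree p) (degree q)" T v]
    poly_act_bound[of q "max (degree p) (degree q)" T v]
    poly_act_bound[of "p + q" "max (degree p) (degree q)" T v] degree_add_le_max[of p q]
  by (simp add: scale_left_distrib sum.distrib)

lemma poly_act_smult: "poly_act T (smult c p) v = scale c (poly_act T p v)"
  using poly_act_bound[of "smult c p" "degree p" T v] poly_act_bound[of p "degree p" T v]
    degree_smult_le[of c p]
  by (simp add: scale_sum_right)

lemma poly_act_monom: "poly_act T (monom 1 k) v = (T ^^ k) v"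
proof -
  have "poly_act T (monom 1 k) v = (\<Sum>i\<le>k. if i = k then (T ^^ i) v else 0)"
    by (subst poly_act_bound[OF degree_monom_le]) (rule sum.cong, auto)
  then show ?thesis by simp
qed

lemma poly_act_in:
  assumes "endo T" "v \<in> V"
  shows "poly_act T p v \<in> V"
  using assms endo_funpow[OF assms(1)] unfolding poly_act_def
  by (intro subspace_sum subspace_scale subspace_V) (auto simp: endo_def)

lemma poly_act_pCons_0:
  assumes "endo T" "v \<in> V"
  shows "poly_act T (pCons 0 p) v = T (poly_act T p v)"
proof -
  have "poly_act T (pCons 0 p) v = (\<Sum>i\<le>degree p. scale (coeff p i) ((T ^^ Suc i) v))"
    by (subst poly_act_bound[of _ "Suc (degree p)"])
      (auto simp: sum.atMost_Suc_shift degree_pCons_le simp del: sum.atMost_Suc)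
  also have "\<dots> = T (poly_act T p v)"
    unfolding poly_act_def using assms endo_funpow[OF assms(1)]
    by (subst endo_sum[OF assms(1)]) (auto simp: endo_def)
  finally show ?thesis .
qed

lemma poly_act_linear_factor:
  assumes "endo T" "v \<in> V"
  shows "poly_act T ([:- c, 1:] * q) v = T (poly_act T q v) - scale c (poly_act T q v)"
proof -
  have "[:- c, 1:] * q = smult (- c) q + pCons 0 q" by simp
  then show ?thesis
    by (simp only: poly_act_add poly_act_smult poly_act_pCons_0[OF assms])
      (simp add: algebra_simps)
qed

text \<open>Finite dimension forces some iterate of \<open>v\<close> into the span of the earlier
  ones, and this dependency, read as a polynomial, annihilates \<open>v\<close>.\<close>

lemma annihilating_poly_exists:
  assumes T: "endo T" and v: "v \<in> V"
  shows "\<exists>p. p \<noteq> 0 \<and> poly_act T p v = 0"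
proof -
  let ?A = "\<lambda>k. (\<lambda>i. (T ^^ i) v) ` {..<k}"
  have inV: "(T ^^ i) v \<in> V" for i
    using endo_funpow[OF T] v by (auto simp: endo_def)
  obtain F where F: "finite F" "V = span F" using finite_span by blast
  have "\<exists>k. (T ^^ k) v \<in> span (?A k)"
  proof (rule ccontr)
    assume "\<nexists>k. (T ^^ k) v \<in> span (?A k)"
    then have nin: "(T ^^ k) v \<notin> span (?A k)" for k by blast
    have "independent (?A k) \<and> card (?A k) = k" for k
    proof (induction k)
      case (Suc k)
      have A: "?A (Suc k) = insert ((T ^^ k) v) (?A k)"
        by (simp only: lessThan_Suc image_insert)
      have "(T ^^ k) v \<notin> ?A k" using nin[of k] span_base[of "(T ^^ k) v" "?A k"] by metis
      moreover have "independent (insert ((T ^^ k) v) (?A k))"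
        using Suc.IH nin[of k] by (intro independent_insertI) simp_all
      ultimately show ?case
        using Suc.IH unfolding A by (subst card_insert_disjoint) simp_all
    qed (simp add: independent_empty)
    then have "Suc (card F) \<le> card F"
      using independent_span_bound[OF F(1), of "?A (Suc (card F))"] inV F(2)
      by (simp add: image_subset_iff del: funpow.simps)
    then show False by linarith
  qed
  then obtain k where k: "(T ^^ k) v \<in> span (?A k)" by blast
  \<comment> \<open>The dependency as a polynomial. Bounding coefficients instead of the degree also
    covers \<open>k = 0\<close>, where \<open>q\<close> is 0.\<close>
  have "\<exists>q. (\<forall>j\<ge>k. coeff q j = 0) \<and> poly_act T q v = x" if "x \<in> span (?A k)" for x
    using that
  proof (induction rule: span_induct_alt)
    case base
    show ?case by (intro exI[of _ 0]) (simp add: poly_act_def)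
  next
    case (step c x y)
    then obtain i q where i: "i < k" "x = (T ^^ i) v" and q: "\<forall>j\<ge>k. coeff q j = 0" "poly_act T q v = y"
      by auto
    have "poly_act T (smult c (monom 1 i) + q) v = scale c x + y"
      by (simp only: poly_act_add poly_act_smult poly_act_monom i q)
    then show ?case using i(1) q(1)
      by (intro exI[of _ "smult c (monom 1 i) + q"]) auto
  qed
  then obtain q where q: "\<forall>j\<ge>k. coeff q j = 0" "poly_act T q v = (T ^^ k) v" using k by blast
  have "coeff (monom 1 k + smult (-1) q) k = 1" using q(1) by simp
  then have "monom 1 k + smult (-1) q \<noteq> 0" by (metis coeff_0 zero_neq_one)
  moreover have "poly_act T (monom 1 k + smult (-1) q) v = 0"
    by (simp only: poly_act_add poly_act_smult poly_act_monom q) simp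
  ultimately show ?thesis by blast
qed

text \<open>Split linear factors off an annihilating polynomial: as soon as \<open>q(T) v\<close> is
  nonzero while \<open>(T - c) q(T) v\<close> is 0, the former is the eigenvector. The assumption
  \<open>closed\<close> is later supplied by the fundamental theorem of algebra.\<close>

lemma eigenvector_exists:
  assumes closed: "\<And>p :: 'a poly. degree p \<noteq> 0 \<Longrightarrow> \<exists>c. poly p c = 0"
    and T: "endo T" and v: "v \<in> V" "v \<noteq> 0"
  shows "\<exists>c. \<exists>u\<in>V. u \<noteq> 0 \<and> T u = scale c u"
proof -
  have "\<exists>c. \<exists>u\<in>V. u \<noteq> 0 \<and> T u = scale c u" if "p \<noteq> 0" "poly_act T p v = 0" for p
    using that
  proof (induction "degree p" arbitrary: p rule: less_induct)
    case less
    have "degree p \<noteq> 0"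
    proof
      assume 0: "degree p = 0"
      then have "coeff p 0 \<noteq> 0" using less.prems(1) leading_coeff_0_iff by metis
      then show False using 0 less.prems(2) v(2) by (simp add: poly_act_def)
    qed
    then obtain c q where q: "p = [:- c, 1:] * q"
      using closed[of p] by (auto simp: poly_eq_0_iff_dvd elim!: dvdE)
    then have "q \<noteq> 0" using less.prems by auto
    then have deg: "degree q < degree p" using q by (simp add: degree_mult_eq del: mult_pCons_left)
    show ?case
    proof (cases "poly_act T q v = 0")
      case True
      then show ?thesis using less.hyps deg \<open>q \<noteq> 0\<close> by blast
    next
      case False
      then show ?thesis
        using less.prems(2) poly_act_linear_factor[OF T v(1), of c q] poly_act_in[OF T v(1)] q
        by (metis eq_iff_diff_eq_0)
    qed
  qed
  then show ?thesis using annihilating_poly_exists[OF T v(1)] by blast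
qed

end

hide_const (open) Polynomial.smult

declare rot.simps [simp del] twist.simps [simp del]

section \<open>Whiskering and duals in strict monoidal categories\<close>

text \<open>
  An element of \<open>'m\<close> does not determine its source and target. Pairing it with them makes
  composability a condition on terms that the simplifier can decide.
\<close>

datatype ('o, 'm) arrow = Arrow (src: 'o) (mor: 'm) (tgt: 'o)

context strict_monoidal_linear_category
begin

declare unit_obj [simp] tens_obj [simp] tens_assoc [simp] tens_unit_left [simp] tens_unit_right [simp]

section \<open>Arrows and whiskering\<close>

definition arr :: "('o, 'm) arrow \<Rightarrow> bool" where
  "arr F \<longleftrightarrow> src F \<in> obj C \<and> tgt F \<in> obj C \<and> mor F \<in> hom C (src F) (tgt F)"

definition cmp :: "('o, 'm) arrow \<Rightarrow> ('o, 'm) arrow \<Rightarrow> ('o, 'm) arrow"  (infixr \<open>\<odot>\<close> 70) where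
  "G \<odot> F = Arrow (src F) (mor G \<cdot> mor F) (tgt G)"

definition idn :: "'o \<Rightarrow> ('o, 'm) arrow" where
  "idn x = Arrow x (\<i>\<d> x) x"

text \<open>Whiskerings suffice, since a tensor product of two arrows is a composite of two of them.
  The simp rules below turn a diagram into a right-nested composite of single whiskered
  arrows.\<close>

definition lw :: "'o \<Rightarrow> ('o, 'm) arrow \<Rightarrow> ('o, 'm) arrow"  (infixr \<open>\<rhd>\<close> 80) where
  "x \<rhd> F = Arrow (x \<otimes>\<^sub>o src F) (\<i>\<d> x \<otimes>\<^sub>m mor F) (x \<otimes>\<^sub>o tgt F)"

definition rw :: "('o, 'm) arrow \<Rightarrow> 'o \<Rightarrow> ('o, 'm) arrow"  (infixl \<open>\<lhd>\<close> 81) where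
  "F \<lhd> x = Arrow (src F \<otimes>\<^sub>o x) (mor F \<otimes>\<^sub>m \<i>\<d> x) (tgt F \<otimes>\<^sub>o x)"

lemma src_tgt [simp]:
  "src (G \<odot> F) = src F" "tgt (G \<odot> F) = tgt G"
  "src (idn x) = x" "tgt (idn x) = x"
  "src (x \<rhd> F) = x \<otimes>\<^sub>o src F" "tgt (x \<rhd> F) = x \<otimes>\<^sub>o tgt F"
  "src (F \<lhd> x) = src F \<otimes>\<^sub>o x" "tgt (F \<lhd> x) = tgt F \<otimes>\<^sub>o x"
  by (simp_all add: cmp_def idn_def lw_def rw_def)

lemma arr_obj: "arr F \<Longrightarrow> src F \<in> obj C" "arr F \<Longrightarrow> tgt F \<in> obj C"
  by (simp_all add: arr_def)

lemma arr_Arrow: "arr (Arrow x f y) \<longleftrightarrow> x \<in> obj C \<and> y \<in> obj C \<and> f \<in> hom C x y"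
  by (simp add: arr_def)

lemma arr_cmp [simp]: "arr G \<Longrightarrow> arr F \<Longrightarrow> src G = tgt F \<Longrightarrow> arr (G \<odot> F)"
  using comp_hom[of "src F" "src G" "tgt G" "mor F" "mor G"] by (simp add: arr_def cmp_def)

lemma arr_idn [simp]: "x \<in> obj C \<Longrightarrow> arr (idn x)"
  by (auto simp: arr_def idn_def ident_hom)

lemma arr_lw [simp]: "x \<in> obj C \<Longrightarrow> arr F \<Longrightarrow> arr (x \<rhd> F)"
  using tens_hom[of x x "src F" "tgt F" "\<i>\<d> x" "mor F"] by (simp add: arr_def lw_def ident_hom)

lemma arr_rw [simp]: "x \<in> obj C \<Longrightarrow> arr F \<Longrightarrow> arr (F \<lhd> x)"
  using tens_hom[of "src F" "tgt F" x x "mor F" "\<i>\<d> x"] by (simp add: arr_def rw_def ident_hom)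

lemma cmp_assoc [simp]:
  "arr H \<Longrightarrow> arr G \<Longrightarrow> arr F \<Longrightarrow> src H = tgt G \<Longrightarrow> src G = tgt F \<Longrightarrow> (H \<odot> G) \<odot> F = H \<odot> (G \<odot> F)"
  using comp_assoc[of "src F" "src G" "src H" "tgt H" "mor F" "mor G" "mor H"]
  by (simp add: arr_def cmp_def)

lemma cmp_idn [simp]:
  "arr F \<Longrightarrow> tgt F = x \<Longrightarrow> idn x \<odot> F = F"
  "arr F \<Longrightarrow> src F = x \<Longrightarrow> F \<odot> idn x = F"
  using ident_left[of "src F" "tgt F" "mor F"] ident_right[of "src F" "tgt F" "mor F"]
  by (auto simp: arr_def cmp_def idn_def intro: arrow.expand)

lemma whisker_cmp [simp]:
  "x \<in> obj C \<Longrightarrow> arr G \<Longrightarrow> arr F \<Longrightarrow> src G = tgt F \<Longrightarrow> x \<rhd> (G \<odot> F) = x \<rhd> G \<odot> x \<rhd> F"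
  "x \<in> obj C \<Longrightarrow> arr G \<Longrightarrow> arr F \<Longrightarrow> src G = tgt F \<Longrightarrow> (G \<odot> F) \<lhd> x = G \<lhd> x \<odot> F \<lhd> x"
  using interchange[of x x x "src F" "src G" "tgt G" "\<i>\<d> x" "\<i>\<d> x" "mor F" "mor G"]
    interchange[of "src F" "src G" "tgt G" x x x "mor F" "mor G" "\<i>\<d> x" "\<i>\<d> x"]
    ident_left[of x x "\<i>\<d> x"]
  by (auto simp: arr_def cmp_def lw_def rw_def ident_hom)

lemma whisker_whisker [simp]:
  "x \<in> obj C \<Longrightarrow> y \<in> obj C \<Longrightarrow> arr F \<Longrightarrow> x \<rhd> (y \<rhd> F) = (x \<otimes>\<^sub>o y) \<rhd> F"
  "x \<in> obj C \<Longrightarrow> y \<in> obj C \<Longrightarrow> arr F \<Longrightarrow> (F \<lhd> x) \<lhd> y = F \<lhd> (x \<otimes>\<^sub>o y)"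
  "x \<in> obj C \<Longrightarrow> y \<in> obj C \<Longrightarrow> arr F \<Longrightarrow> (x \<rhd> F) \<lhd> y = x \<rhd> (F \<lhd> y)"
  using tens_hom_assoc[of x x y y "src F" "tgt F" "\<i>\<d> x" "\<i>\<d> y" "mor F"]
    tens_hom_assoc[of "src F" "tgt F" x x y y "mor F" "\<i>\<d> x" "\<i>\<d> y"]
    tens_hom_assoc[of x x "src F" "tgt F" y y "\<i>\<d> x" "mor F" "\<i>\<d> y"]
  by (auto simp: arr_def lw_def rw_def ident_hom tens_ident)

lemma whisker_idn [simp]:
  "x \<in> obj C \<Longrightarrow> y \<in> obj C \<Longrightarrow> x \<rhd> idn y = idn (x \<otimes>\<^sub>o y)"
  "x \<in> obj C \<Longrightarrow> y \<in> obj C \<Longrightarrow> idn x \<lhd> y = idn (x \<otimes>\<^sub>o y)"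
  by (auto simp: idn_def lw_def rw_def tens_ident)

lemma whisker_unit [simp]: "arr F \<Longrightarrow> \<one>\<^sub>o \<rhd> F = F" "arr F \<Longrightarrow> F \<lhd> \<one>\<^sub>o = F"
  using tens_hom_unit_left[of "src F" "tgt F" "mor F"] tens_hom_unit_right[of "src F" "tgt F" "mor F"]
  by (auto simp: arr_def lw_def rw_def intro: arrow.expand)

text \<open>Both sides are \<open>mor F \<otimes>\<^sub>m mor G\<close>. Neither order is a normal
  form, so later proofs move one box past another by hand.\<close>

lemma whisker_exchange:
  assumes "arr F" "arr G"
  shows "tgt F \<rhd> G \<odot> F \<lhd> src G = F \<lhd> tgt G \<odot> src F \<rhd> G"
proof -
  have "tgt F \<rhd> G \<odot> F \<lhd> src G = Arrow (src F \<otimes>\<^sub>o src G) (mor F \<otimes>\<^sub>m mor G) (tgt F \<otimes>\<^sub>o tgt G)"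
    using interchange[of "src F" "tgt F" "tgt F" "src G" "src G" "tgt G" "mor F" "\<i>\<d> (tgt F)" "\<i>\<d> (src G)" "mor G"]
      assms ident_left[of "src F" "tgt F" "mor F"] ident_right[of "src G" "tgt G" "mor G"]
    by (simp add: arr_def cmp_def lw_def rw_def ident_hom)
  also have "\<dots> = F \<lhd> tgt G \<odot> src F \<rhd> G"
    using interchange[of "src F" "src F" "tgt F" "src G" "tgt G" "tgt G" "\<i>\<d> (src F)" "mor F" "mor G" "\<i>\<d> (tgt G)"]
      assms ident_left[of "src G" "tgt G" "mor G"] ident_right[of "src F" "tgt F" "mor F"]
    by (simp add: arr_def cmp_def lw_def rw_def ident_hom)
  finally show ?thesis .
qed

declare arr_obj [simp]

section \<open>Linear structure on arrows\<close>

definition add :: "('o, 'm) arrow \<Rightarrow> ('o, 'm) arrow \<Rightarrow> ('o, 'm) arrow"  (infixl \<open>\<oplus>\<close> 65) where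
  "F \<oplus> G = Arrow (src F) (mor F + mor G) (tgt F)"

definition scl :: "complex \<Rightarrow> ('o, 'm) arrow \<Rightarrow> ('o, 'm) arrow"  (infixr \<open>\<bullet>\<close> 75) where
  "c \<bullet> F = Arrow (src F) (smult C c (mor F)) (tgt F)"

lemma src_tgt_linear [simp]:
  "src (F \<oplus> G) = src F" "tgt (F \<oplus> G) = tgt F" "mor (F \<oplus> G) = mor F + mor G"
  "src (c \<bullet> F) = src F" "tgt (c \<bullet> F) = tgt F" "mor (c \<bullet> F) = smult C c (mor F)"
  by (simp_all add: add_def scl_def)

lemma arr_linear [simp]:
  "arr F \<Longrightarrow> arr G \<Longrightarrow> src F = src G \<Longrightarrow> tgt F = tgt G \<Longrightarrow> arr (F \<oplus> G)"
  "arr F \<Longrightarrow> arr (c \<bullet> F)"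
  using subspace_add[OF hom_subspace] subspace_scale[OF hom_subspace] unfolding arr_def
  by (auto simp del: arr_obj)

lemma cmp_add [simp]:
  "arr F \<Longrightarrow> arr G \<Longrightarrow> arr H \<Longrightarrow> src F = src G \<Longrightarrow> tgt F = tgt G \<Longrightarrow> src F = tgt H
    \<Longrightarrow> (F \<oplus> G) \<odot> H = F \<odot> H \<oplus> G \<odot> H"
  "arr F \<Longrightarrow> arr G \<Longrightarrow> arr H \<Longrightarrow> src F = src G \<Longrightarrow> tgt F = tgt G \<Longrightarrow> src H = tgt F
    \<Longrightarrow> H \<odot> (F \<oplus> G) = H \<odot> F \<oplus> H \<odot> G"
  using comp_add_left[of "src H" "tgt H" "tgt F" "mor H" "mor F" "mor G"]
    comp_add_right[of "src F" "tgt F" "tgt H" "mor F" "mor G" "mor H"]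
  unfolding arr_def cmp_def add_def by (auto simp del: arr_obj)

lemma cmp_scl [simp]:
  "arr F \<Longrightarrow> arr H \<Longrightarrow> src F = tgt H \<Longrightarrow> (c \<bullet> F) \<odot> H = c \<bullet> (F \<odot> H)"
  "arr F \<Longrightarrow> arr H \<Longrightarrow> src H = tgt F \<Longrightarrow> H \<odot> (c \<bullet> F) = c \<bullet> (H \<odot> F)"
  using comp_smult_left[of "src H" "tgt H" "tgt F" "mor H" "mor F" c]
    comp_smult_right[of "src F" "tgt F" "tgt H" "mor F" "mor H" c]
  unfolding arr_def cmp_def scl_def by (auto simp del: arr_obj)

lemma whisker_add [simp]:
  assumes "arr F" "arr G" "src F = src G" "tgt F = tgt G" "x \<in> obj C"
  shows "x \<rhd> (F \<oplus> G) = x \<rhd> F \<oplus> x \<rhd> G" "(F \<oplus> G) \<lhd> x = F \<lhd> x \<oplus> G \<lhd> x"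
  using assms tens_add_left[of "src F" "tgt F" x x "mor F" "mor G" "\<i>\<d> x"]
    tens_add_right[of x x "src F" "tgt F" "\<i>\<d> x" "mor F" "mor G"]
  unfolding arr_def lw_def rw_def add_def by (auto simp: ident_hom simp del: arr_obj)

lemma whisker_scl [simp]:
  assumes "arr F" "x \<in> obj C"
  shows "x \<rhd> (c \<bullet> F) = c \<bullet> (x \<rhd> F)" "(c \<bullet> F) \<lhd> x = c \<bullet> (F \<lhd> x)"
  using assms tens_smult_left[of "src F" "tgt F" x x "mor F" "\<i>\<d> x" c]
    tens_smult_right[of x x "src F" "tgt F" "\<i>\<d> x" "mor F" c]
  unfolding arr_def lw_def rw_def scl_def by (auto simp: ident_hom simp del: arr_obj)

text \<open>Zero travels through composites as the scalar 0, since only the bilinearity axioms on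
  typed Hom spaces say how the untyped operations treat it.\<close>

lemma zero_arrow: "mor F = 0 \<Longrightarrow> F = 0 \<bullet> F"
  by (cases F) (simp add: scl_def)

lemma mor_cmp_zero:
  "arr F \<Longrightarrow> arr G \<Longrightarrow> src G = tgt F \<Longrightarrow> mor F = 0 \<or> mor G = 0 \<Longrightarrow> mor (G \<odot> F) = 0"
  by (auto dest!: zero_arrow) (metis cmp_scl scale_zero_left src_tgt_linear(6))+

lemma mor_whisker_zero:
  assumes "arr F" "x \<in> obj C" "mor F = 0"
  shows "mor (x \<rhd> F) = 0" "mor (F \<lhd> x) = 0"
  using assms whisker_scl[of F x 0] zero_arrow[of F] by (metis scale_zero_left src_tgt_linear(6))+

lemma tens_pow_obj [simp]: "a \<in> obj C \<Longrightarrow> tens_pow C a n \<in> obj C"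
  by (induction n) auto

lemma tens_pow_add: "a \<in> obj C \<Longrightarrow> tens_pow C a (m + n) = tens_pow C a m \<otimes>\<^sub>o tens_pow C a n"
  by (induction m) auto

end

context strict_pivotal_linear_category
begin

declare dual_obj [simp] dual_dual [simp] dual_tens [simp] dual_unit [simp]

section \<open>Caps, cups and transposes\<close>

definition EV :: "'a \<Rightarrow> ('a, 'b) arrow" where
  "EV a = Arrow (dual C a \<otimes>\<^sub>o a) (ev C a) \<one>\<^sub>o"

definition CO :: "'a \<Rightarrow> ('a, 'b) arrow" where
  "CO a = Arrow \<one>\<^sub>o (coev C a) (a \<otimes>\<^sub>o dual C a)"

lemma EV_CO_simps [simp]:
  "a \<in> obj C \<Longrightarrow> arr (EV a)" "src (EV a) = dual C a \<otimes>\<^sub>o a" "tgt (EV a) = \<one>\<^sub>o"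
  "a \<in> obj C \<Longrightarrow> arr (CO a)" "src (CO a) = \<one>\<^sub>o" "tgt (CO a) = a \<otimes>\<^sub>o dual C a"
  by (auto simp: EV_def CO_def arr_Arrow ev_hom coev_hom)

lemma zig: "a \<in> obj C \<Longrightarrow> a \<rhd> EV a \<odot> CO a \<lhd> a = idn a"
  using zigzag[of a] by (simp add: EV_def CO_def lw_def rw_def cmp_def idn_def)

lemma zag: "a \<in> obj C \<Longrightarrow> EV a \<lhd> dual C a \<odot> dual C a \<rhd> CO a = idn (dual C a)"
  using zigzag_dual[of a] by (simp add: EV_def CO_def lw_def rw_def cmp_def idn_def)

lemma EV_tens:
  assumes "a \<in> obj C" "b \<in> obj C"
  shows "EV (a \<otimes>\<^sub>o b) = EV b \<odot> dual C b \<rhd> (EV a \<lhd> b)"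
  using assms by (simp add: EV_def lw_def rw_def cmp_def ev_tens)

definition DU :: "('a, 'b) arrow \<Rightarrow> ('a, 'b) arrow" where
  "DU F = EV (tgt F) \<lhd> dual C (src F) \<odot> dual C (tgt F) \<rhd> (F \<lhd> dual C (src F)) \<odot> dual C (tgt F) \<rhd> CO (src F)"

lemma DU_simps [simp]:
  "arr F \<Longrightarrow> arr (DU F)" "arr F \<Longrightarrow> src (DU F) = dual C (tgt F)" "arr F \<Longrightarrow> tgt (DU F) = dual C (src F)"
  by (simp_all add: DU_def)

text \<open>Naturality of the pivotal structure enters here. It lets a morphism leave a cap on one
  side of \<open>b\<close> and return through a cap on the other side with the same
  transpose.\<close>

lemma DU_right:
  assumes "arr F"
  shows "DU F = dual C (src F) \<rhd> EV (dual C (tgt F))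
    \<odot> dual C (src F) \<rhd> (F \<lhd> dual C (tgt F)) \<odot> CO (dual C (src F)) \<lhd> dual C (tgt F)"
proof -
  have "arr F" "src F \<in> obj C" "tgt F \<in> obj C" "mor F \<in> hom C (src F) (tgt F)"
    using assms unfolding arr_def by blast+
  note d = dual_morphisms[OF this(2-4)]
  have "DU F = (EV (tgt F) \<lhd> dual C (src F) \<odot> dual C (tgt F) \<rhd> (F \<lhd> dual C (src F))) \<odot> dual C (tgt F) \<rhd> CO (src F)"
    using assms by (simp add: DU_def)
  also have "\<dots> = (dual C (src F) \<rhd> EV (dual C (tgt F))
    \<odot> dual C (src F) \<rhd> (F \<lhd> dual C (tgt F))) \<odot> CO (dual C (src F)) \<lhd> dual C (tgt F)"
    using d assms by (simp add: EV_def CO_def lw_def rw_def cmp_def)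
  finally show ?thesis using assms by simp
qed

text \<open>Unfolding \<open>DU\<close> creates an extra cap and cup on \<open>x\<close>; once the
  two caps are exchanged, these straighten by \<open>zig\<close>.\<close>

lemma EV_slide:
  assumes F: "arr F" "src F = x" "tgt F = y"
  shows "EV y \<odot> dual C y \<rhd> F = EV x \<odot> DU F \<lhd> x"
proof -
  have [simp]: "x \<in> obj C" "y \<in> obj C" using F by auto
  let ?x = "dual C x" and ?y = "dual C y"
  have "EV x \<odot> DU F \<lhd> x = (EV x \<odot> (EV y \<odot> ?y \<rhd> F) \<lhd> (?x \<otimes>\<^sub>o x)) \<odot> ?y \<rhd> CO x \<lhd> x"
    using F by (simp add: DU_def)
  also have "EV x \<odot> (EV y \<odot> ?y \<rhd> F) \<lhd> (?x \<otimes>\<^sub>o x) = (EV y \<odot> ?y \<rhd> F) \<odot> (?y \<otimes>\<^sub>o x) \<rhd> EV x"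
    using whisker_exchange[of "EV y \<odot> ?y \<rhd> F" "EV x"] F by simp
  also have "\<dots> \<odot> ?y \<rhd> CO x \<lhd> x = (EV y \<odot> ?y \<rhd> F) \<odot> ?y \<rhd> (x \<rhd> EV x \<odot> CO x \<lhd> x)"
    using F by simp
  also have "\<dots> = EV y \<odot> ?y \<rhd> F" using F by (subst zig) simp_all
  finally show ?thesis by simp
qed

lemma EV_slide_right:
  assumes F: "arr F" "src F = x" "tgt F = y"
  shows "EV (dual C y) \<odot> F \<lhd> dual C y = EV (dual C x) \<odot> x \<rhd> DU F"
proof -
  have [simp]: "x \<in> obj C" "y \<in> obj C" using F by auto
  let ?x = "dual C x" and ?y = "dual C y"
  have "EV ?x \<odot> x \<rhd> DU F = (EV ?x \<odot> (x \<otimes>\<^sub>o ?x) \<rhd> (EV ?y \<odot> F \<lhd> ?y)) \<odot> x \<rhd> CO ?x \<lhd> ?y"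
    using F by (simp add: DU_right)
  also have "EV ?x \<odot> (x \<otimes>\<^sub>o ?x) \<rhd> (EV ?y \<odot> F \<lhd> ?y) = (EV ?y \<odot> F \<lhd> ?y) \<odot> EV ?x \<lhd> (x \<otimes>\<^sub>o ?y)"
    using whisker_exchange[of "EV ?x" "EV ?y \<odot> F \<lhd> ?y"] F by simp
  also have "\<dots> \<odot> x \<rhd> CO ?x \<lhd> ?y = (EV ?y \<odot> F \<lhd> ?y) \<odot> (EV ?x \<lhd> dual C ?x \<odot> dual C ?x \<rhd> CO ?x) \<lhd> ?y"
    using F by simp
  also have "\<dots> = EV ?y \<odot> F \<lhd> ?y" using F by (subst zag) simp_all
  finally show ?thesis by simp
qed

section \<open>Bending legs\<close>

text \<open>Frobenius reciprocity. The factors \<open>x\<close> and \<open>y\<close> are arguments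
  because the object \<open>tgt S\<close> does not determine them.\<close>

definition bend_left :: "'a \<Rightarrow> 'a \<Rightarrow> ('a, 'b) arrow \<Rightarrow> ('a, 'b) arrow" where
  "bend_left x y S = EV x \<lhd> y \<odot> dual C x \<rhd> S"

definition bend_right :: "'a \<Rightarrow> 'a \<Rightarrow> ('a, 'b) arrow \<Rightarrow> ('a, 'b) arrow" where
  "bend_right x y G = y \<rhd> EV (dual C x) \<odot> G \<lhd> dual C x"

lemma bend_left_simps [simp]:
  assumes "arr S" "x \<in> obj C" "y \<in> obj C" "tgt S = x \<otimes>\<^sub>o y"
  shows "arr (bend_left x y S)" "src (bend_left x y S) = dual C x \<otimes>\<^sub>o src S" "tgt (bend_left x y S) = y"
  using assms by (simp_all add: bend_left_def)

lemma bend_right_simps [simp]: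
  assumes "arr S" "x \<in> obj C" "y \<in> obj C" "tgt S = y \<otimes>\<^sub>o x"
  shows "arr (bend_right x y S)" "src (bend_right x y S) = src S \<otimes>\<^sub>o dual C x" "tgt (bend_right x y S) = y"
  using assms by (simp_all add: bend_right_def)

lemma unbend_left:
  assumes "arr S" "x \<in> obj C" "y \<in> obj C" "tgt S = x \<otimes>\<^sub>o y"
  shows "x \<rhd> bend_left x y S \<odot> CO x \<lhd> src S = S"
proof -
  have "x \<rhd> bend_left x y S \<odot> CO x \<lhd> src S = x \<rhd> EV x \<lhd> y \<odot> ((x \<otimes>\<^sub>o dual C x) \<rhd> S \<odot> CO x \<lhd> src S)"
    using assms by (simp add: bend_left_def)
  also have "(x \<otimes>\<^sub>o dual C x) \<rhd> S \<odot> CO x \<lhd> src S = CO x \<lhd> tgt S \<odot> S"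
    using assms whisker_exchange[of "CO x" S] by simp
  also have "x \<rhd> EV x \<lhd> y \<odot> (CO x \<lhd> tgt S \<odot> S) = (x \<rhd> EV x \<odot> CO x \<lhd> x) \<lhd> y \<odot> S"
    using assms by simp
  also have "\<dots> = S" using assms by (subst zig) simp_all
  finally show ?thesis .
qed

lemma unbend_right:
  assumes "arr G" "x \<in> obj C" "y \<in> obj C" "tgt G = y \<otimes>\<^sub>o x"
  shows "bend_right x y G \<lhd> x \<odot> src G \<rhd> CO (dual C x) = G"
proof -
  have "bend_right x y G \<lhd> x \<odot> src G \<rhd> CO (dual C x)
      = y \<rhd> EV (dual C x) \<lhd> x \<odot> (G \<lhd> (dual C x \<otimes>\<^sub>o x) \<odot> src G \<rhd> CO (dual C x))"
    using assms by (simp add: bend_right_def)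
  also have "G \<lhd> (dual C x \<otimes>\<^sub>o x) \<odot> src G \<rhd> CO (dual C x) = tgt G \<rhd> CO (dual C x) \<odot> G"
    using assms whisker_exchange[of G "CO (dual C x)"] by simp
  also have "y \<rhd> EV (dual C x) \<lhd> x \<odot> (tgt G \<rhd> CO (dual C x) \<odot> G)
      = y \<rhd> (EV (dual C x) \<lhd> dual C (dual C x) \<odot> dual C (dual C x) \<rhd> CO (dual C x)) \<odot> G"
    using assms by simp
  also have "\<dots> = G" using assms by (subst zag) simp_all
  finally show ?thesis .
qed

text \<open>The opposite round trip to \<open>unbend_right\<close>: every arrow out of
  \<open>v \<otimes>\<^sub>o dual C x\<close> is a bent one, so a rotation may be specified by its
  bent form.\<close>

lemma bend_right_unbend:
  assumes "arr H" "x \<in> obj C" "v \<in> obj C" "src H = v \<otimes>\<^sub>o dual C x"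
  shows "bend_right x (tgt H) (H \<lhd> x \<odot> v \<rhd> CO (dual C x)) = H"
proof -
  let ?x = "dual C x"
  have "bend_right x (tgt H) (H \<lhd> x \<odot> v \<rhd> CO ?x)
      = (tgt H \<rhd> EV ?x \<odot> H \<lhd> (x \<otimes>\<^sub>o ?x)) \<odot> v \<rhd> CO ?x \<lhd> ?x"
    using assms by (simp add: bend_right_def)
  also have "tgt H \<rhd> EV ?x \<odot> H \<lhd> (x \<otimes>\<^sub>o ?x) = H \<odot> src H \<rhd> EV ?x"
    using assms whisker_exchange[of H "EV ?x"] by simp
  also have "\<dots> \<odot> v \<rhd> CO ?x \<lhd> ?x = H \<odot> v \<rhd> (?x \<rhd> EV ?x \<odot> CO ?x \<lhd> ?x)"
    using assms by simp
  also have "\<dots> = H" using assms by (subst zig) simp_all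
  finally show ?thesis .
qed

end

section \<open>Rotation around an object of the center\<close>

locale half_braided_object = strict_pivotal_linear_category C
  for C :: "('o, 'm::ab_group_add, 'z) piv_cat_scheme" (structure) +
  fixes b :: 'o and e :: "'o \<Rightarrow> 'm"
  assumes b_obj [simp]: "b \<in> obj C" and half_braiding: "half_braiding C b e"
begin

definition E :: "'o \<Rightarrow> ('o, 'm) arrow" where
  "E x = Arrow (b \<otimes>\<^sub>o x) (e x) (x \<otimes>\<^sub>o b)"

lemma E_simps [simp]: "src (E x) = b \<otimes>\<^sub>o x" "tgt (E x) = x \<otimes>\<^sub>o b" "x \<in> obj C \<Longrightarrow> arr (E x)"
  using half_braiding by (auto simp: E_def arr_Arrow half_braiding_def is_iso_def)

lemma E_natural:
  assumes F: "arr F" "src F = x" "tgt F = y"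
  shows "F \<lhd> b \<odot> E x = E y \<odot> b \<rhd> F"
proof -
  have "x \<in> obj C" "y \<in> obj C" "mor F \<in> hom C x y"
    using F unfolding arr_def by blast+
  then show ?thesis using half_braiding F by (auto simp: half_braiding_def E_def cmp_def lw_def rw_def)
qed

lemma E_tens: "x \<in> obj C \<Longrightarrow> y \<in> obj C \<Longrightarrow> E (x \<otimes>\<^sub>o y) = x \<rhd> E y \<odot> E x \<lhd> y"
  using half_braiding by (auto simp: half_braiding_def E_def cmp_def lw_def rw_def)

lemma E_inverse:
  assumes "x \<in> obj C"
  obtains G where "arr G" "src G = x \<otimes>\<^sub>o b" "tgt G = b \<otimes>\<^sub>o x"
    "G \<odot> E x = idn (b \<otimes>\<^sub>o x)" "E x \<odot> G = idn (x \<otimes>\<^sub>o b)"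
proof -
  obtain g where "g \<in> hom C (x \<otimes>\<^sub>o b) (b \<otimes>\<^sub>o x)" "g \<cdot> e x = \<i>\<d> (b \<otimes>\<^sub>o x)" "e x \<cdot> g = \<i>\<d> (x \<otimes>\<^sub>o b)"
    using half_braiding assms by (auto simp: half_braiding_def is_iso_def)
  then show thesis
    using assms by (intro that[of "Arrow (x \<otimes>\<^sub>o b) g (b \<otimes>\<^sub>o x)"])
      (auto simp: arr_Arrow E_def cmp_def idn_def)
qed

text \<open>Tensor compatibility at \<open>\<one>\<^sub>o\<close> makes this component idempotent,
  and an invertible idempotent is an identity.\<close>

lemma E_unit: "E \<one>\<^sub>o = idn b"
proof -
  obtain G where G: "arr G" "src G = b" "tgt G = b" "G \<odot> E \<one>\<^sub>o = idn b"
    using E_inverse[of "\<one>\<^sub>o"] by auto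
  have "E \<one>\<^sub>o = E \<one>\<^sub>o \<odot> E \<one>\<^sub>o" using E_tens[of "\<one>\<^sub>o" "\<one>\<^sub>o"] by simp
  then have "(G \<odot> E \<one>\<^sub>o) = (G \<odot> E \<one>\<^sub>o) \<odot> E \<one>\<^sub>o" using G(1-3) by simp
  then show ?thesis using G by simp
qed

section \<open>Rotation of a leg around \<open>b\<close>\<close>

definition rotate :: "'o \<Rightarrow> 'o \<Rightarrow> ('o, 'm) arrow \<Rightarrow> ('o, 'm) arrow" where
  "rotate x y S = (bend_left x y S \<odot> E (dual C x)) \<lhd> x \<odot> b \<rhd> CO (dual C x)"

lemma rotate_simps [simp]:
  assumes "arr S" "x \<in> obj C" "y \<in> obj C" "src S = b" "tgt S = x \<otimes>\<^sub>o y"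
  shows "arr (rotate x y S)" "src (rotate x y S) = b" "tgt (rotate x y S) = y \<otimes>\<^sub>o x"
  using assms by (simp_all add: rotate_def bend_left_def)

lemma bend_right_rotate:
  assumes "arr S" "x \<in> obj C" "y \<in> obj C" "src S = b" "tgt S = x \<otimes>\<^sub>o y"
  shows "bend_right x y (rotate x y S) = bend_left x y S \<odot> E (dual C x)"
  using bend_right_unbend[of "bend_left x y S \<odot> E (dual C x)" x b] assms
  by (simp add: rotate_def bend_left_def)

text \<open>Bending to the right is injective by \<open>unbend_right\<close>, so candidates may be
  compared in bent form.\<close>

lemma rotate_eqI:
  assumes "arr S" "x \<in> obj C" "y \<in> obj C" "src S = b" "tgt S = x \<otimes>\<^sub>o y"
    and "arr G" "src G = b" "tgt G = y \<otimes>\<^sub>o x"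
    and "bend_left x y S \<odot> E (dual C x) = bend_right x y G"
  shows "rotate x y S = G"
  using unbend_right[of G x y] assms by (simp add: rotate_def)

lemma rotate_inj:
  assumes S: "arr S" "src S = b" "tgt S = x \<otimes>\<^sub>o y" and S': "arr S'" "src S' = b" "tgt S' = x \<otimes>\<^sub>o y"
    and xy: "x \<in> obj C" "y \<in> obj C" and eq: "rotate x y S = rotate x y S'"
  shows "S = S'"
proof -
  obtain G where G: "arr G" "src G = dual C x \<otimes>\<^sub>o b" "tgt G = b \<otimes>\<^sub>o dual C x"
    "E (dual C x) \<odot> G = idn (dual C x \<otimes>\<^sub>o b)"
    using E_inverse[of "dual C x"] xy by auto
  have "(bend_left x y S \<odot> E (dual C x)) \<odot> G = (bend_left x y S' \<odot> E (dual C x)) \<odot> G"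
    using bend_right_rotate[of S x y] bend_right_rotate[of S' x y] assms by simp
  then have "bend_left x y S = bend_left x y S'"
    using G S S' xy by (simp add: bend_left_def)
  then show ?thesis using unbend_left[of S x y] unbend_left[of S' x y] assms by simp
qed

text \<open>The cap on \<open>x \<otimes>\<^sub>o x'\<close> is a pair of nested caps, and the
  half-braiding with its dual crosses the two dual strands one after the other. So the rotation of
  \<open>x\<close> can be completed before that of \<open>x'\<close> starts.\<close>

lemma rotate_tens:
  assumes S: "arr S" "src S = b" "tgt S = x \<otimes>\<^sub>o x' \<otimes>\<^sub>o y"
    and o: "x \<in> obj C" "x' \<in> obj C" "y \<in> obj C"
  shows "rotate (x \<otimes>\<^sub>o x') y S = rotate x' (y \<otimes>\<^sub>o x) (rotate x (x' \<otimes>\<^sub>o y) S)"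
proof (rule rotate_eqI)
  let ?G = "rotate x (x' \<otimes>\<^sub>o y) S" and ?u = "dual C x" and ?u' = "dual C x'"
  let ?H = "rotate x' (y \<otimes>\<^sub>o x) ?G"
  have G: "bend_right x (x' \<otimes>\<^sub>o y) ?G = bend_left x (x' \<otimes>\<^sub>o y) S \<odot> E ?u"
    using S o by (intro bend_right_rotate) auto
  have H: "bend_right x' (y \<otimes>\<^sub>o x) ?H = bend_left x' (y \<otimes>\<^sub>o x) ?G \<odot> E ?u'"
    using S o by (intro bend_right_rotate) auto
  have "bend_left (x \<otimes>\<^sub>o x') y S \<odot> E (dual C (x \<otimes>\<^sub>o x'))
      = EV x' \<lhd> y \<odot> ?u' \<rhd> (bend_left x (x' \<otimes>\<^sub>o y) S \<odot> E ?u) \<odot> E ?u' \<lhd> ?u"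
    using S o by (simp add: bend_left_def EV_tens E_tens)
  also have "\<dots> = (EV x' \<lhd> y \<odot> (?u' \<otimes>\<^sub>o x' \<otimes>\<^sub>o y) \<rhd> EV ?u) \<odot> ?u' \<rhd> ?G \<lhd> ?u \<odot> E ?u' \<lhd> ?u"
    unfolding G[symmetric] using S o by (simp add: bend_right_def)
  also have "EV x' \<lhd> y \<odot> (?u' \<otimes>\<^sub>o x' \<otimes>\<^sub>o y) \<rhd> EV ?u = y \<rhd> EV ?u \<odot> EV x' \<lhd> (y \<otimes>\<^sub>o x \<otimes>\<^sub>o ?u)"
    using whisker_exchange[of "EV x' \<lhd> y" "EV ?u"] o by simp
  also have "\<dots> \<odot> ?u' \<rhd> ?G \<lhd> ?u \<odot> E ?u' \<lhd> ?u = y \<rhd> EV ?u \<odot> (bend_left x' (y \<otimes>\<^sub>o x) ?G \<odot> E ?u') \<lhd> ?u"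
    using S o by (simp add: bend_left_def)
  also have "\<dots> = bend_right (x \<otimes>\<^sub>o x') y ?H"
    unfolding H[symmetric] using S o by (simp add: bend_right_def EV_tens)
  finally show "bend_left (x \<otimes>\<^sub>o x') y S \<odot> E (dual C (x \<otimes>\<^sub>o x')) = bend_right (x \<otimes>\<^sub>o x') y ?H" .
qed (use S o in auto)


lemma rotate_post:
  assumes S: "arr S" "src S = b" "tgt S = x \<otimes>\<^sub>o y" and T: "arr T" "src T = y"
    and o: "x \<in> obj C" "y \<in> obj C"
  shows "rotate x (tgt T) (x \<rhd> T \<odot> S) = T \<lhd> x \<odot> rotate x y S"
proof (rule rotate_eqI)
  let ?x = "dual C x"
  have "bend_left x (tgt T) (x \<rhd> T \<odot> S) \<odot> E ?x
      = (EV x \<lhd> tgt T \<odot> (?x \<otimes>\<^sub>o x) \<rhd> T) \<odot> ?x \<rhd> S \<odot> E ?x"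
    using S T o by (simp add: bend_left_def)
  also have "EV x \<lhd> tgt T \<odot> (?x \<otimes>\<^sub>o x) \<rhd> T = T \<odot> EV x \<lhd> y"
    using whisker_exchange[of "EV x" T] T o by simp
  also have "(T \<odot> EV x \<lhd> y) \<odot> ?x \<rhd> S \<odot> E ?x = T \<odot> bend_right x y (rotate x y S)"
    using S T o by (simp add: bend_right_rotate) (simp add: bend_left_def)
  also have "\<dots> = (T \<odot> y \<rhd> EV ?x) \<odot> rotate x y S \<lhd> ?x"
    using S T o by (simp add: bend_right_def)
  also have "T \<odot> y \<rhd> EV ?x = tgt T \<rhd> EV ?x \<odot> T \<lhd> (x \<otimes>\<^sub>o ?x)"
    using whisker_exchange[of T "EV ?x"] T o by simp
  also have "\<dots> \<odot> rotate x y S \<lhd> ?x = bend_right x (tgt T) (T \<lhd> x \<odot> rotate x y S)"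
    using S T o by (simp add: bend_right_def)
  finally show "bend_left x (tgt T) (x \<rhd> T \<odot> S) \<odot> E ?x = bend_right x (tgt T) (T \<lhd> x \<odot> rotate x y S)" .
qed (use assms in auto)

section \<open>The twist and full rotation\<close>

definition TW :: "('o, 'm) arrow" where
  "TW = b \<rhd> EV (dual C b) \<odot> E b \<lhd> dual C b \<odot> b \<rhd> CO b"

lemma TW_simps [simp]: "arr TW" "src TW = b" "tgt TW = b"
  by (simp_all add: TW_def)

text \<open>Naturality of the half-braiding at \<open>EV x\<close>, whose target is the unit, where
  the half-braiding is trivial.\<close>

lemma E_dual_cancel:
  assumes x: "x \<in> obj C"
  shows "EV x \<lhd> b \<odot> dual C x \<rhd> E x \<odot> E (dual C x) \<lhd> x = b \<rhd> EV x"
proof -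
  have "EV x \<lhd> b \<odot> E (dual C x \<otimes>\<^sub>o x) = E \<one>\<^sub>o \<odot> b \<rhd> EV x"
    using x by (intro E_natural) auto
  then show ?thesis using x by (simp add: E_tens E_unit)
qed

text \<open>The self-crossing in \<open>TW\<close> meets the crossing of \<open>b\<close> with its
  dual and cancels by \<open>E_dual_cancel\<close>; the snake that remains straightens by
  \<open>zag\<close>.\<close>

lemma E_dual_TW: "EV b \<odot> dual C b \<rhd> TW \<odot> E (dual C b) = EV (dual C b)"
proof -
  let ?b = "dual C b"
  have "EV b \<odot> ?b \<rhd> TW \<odot> E ?b
      = (EV b \<odot> (?b \<otimes>\<^sub>o b) \<rhd> EV ?b) \<odot> ?b \<rhd> E b \<lhd> ?b \<odot> ((?b \<otimes>\<^sub>o b) \<rhd> CO b \<odot> E ?b)"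
    by (simp add: TW_def)
  also have "EV b \<odot> (?b \<otimes>\<^sub>o b) \<rhd> EV ?b = EV ?b \<odot> EV b \<lhd> (b \<otimes>\<^sub>o ?b)"
    using whisker_exchange[of "EV b" "EV ?b"] by simp
  also have "(?b \<otimes>\<^sub>o b) \<rhd> CO b \<odot> E ?b = E ?b \<lhd> (b \<otimes>\<^sub>o ?b) \<odot> (b \<otimes>\<^sub>o ?b) \<rhd> CO b"
    using whisker_exchange[of "E ?b" "CO b"] by simp
  also have "(EV ?b \<odot> EV b \<lhd> (b \<otimes>\<^sub>o ?b)) \<odot> ?b \<rhd> E b \<lhd> ?b \<odot> E ?b \<lhd> (b \<otimes>\<^sub>o ?b) \<odot> (b \<otimes>\<^sub>o ?b) \<rhd> CO b
      = EV ?b \<odot> (EV b \<lhd> b \<odot> ?b \<rhd> E b \<odot> E ?b \<lhd> b) \<lhd> ?b \<odot> (b \<otimes>\<^sub>o ?b) \<rhd> CO b"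
    by simp
  also have "\<dots> = EV ?b \<odot> b \<rhd> (EV b \<lhd> ?b \<odot> ?b \<rhd> CO b)"
    by (subst E_dual_cancel) simp_all
  also have "\<dots> = EV ?b" by (subst zag) simp_all
  finally show ?thesis .
qed

text \<open>\<open>F\<close> leaves the left cap as its transpose, passes the crossing by
  naturality, and returns through the right cap by \<open>EV_slide_right\<close>. In between,
  \<open>E_dual_TW\<close> turns the twisted and crossed left cap into the right cap.\<close>

lemma rotate_full:
  assumes F: "arr F" "src F = b" "tgt F = x"
  shows "rotate x \<one>\<^sub>o (F \<odot> TW) = F"
proof (rule rotate_eqI)
  let ?x = "dual C x" and ?b = "dual C b"
  have [simp]: "x \<in> obj C" using F by auto
  have "bend_left x \<one>\<^sub>o (F \<odot> TW) \<odot> E ?x = (EV x \<odot> ?x \<rhd> F) \<odot> ?x \<rhd> TW \<odot> E ?x"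
    using F by (simp add: bend_left_def)
  also have "\<dots> = EV b \<odot> (DU F \<lhd> b \<odot> ?x \<rhd> TW) \<odot> E ?x"
    using F by (subst EV_slide[of F b x]) simp_all
  also have "DU F \<lhd> b \<odot> ?x \<rhd> TW = ?b \<rhd> TW \<odot> DU F \<lhd> b"
    using whisker_exchange[of "DU F" TW] F by simp
  also have "EV b \<odot> \<dots> \<odot> E ?x = EV b \<odot> ?b \<rhd> TW \<odot> (DU F \<lhd> b \<odot> E ?x)"
    using F by simp
  also have "DU F \<lhd> b \<odot> E ?x = E ?b \<odot> b \<rhd> DU F"
    using F by (intro E_natural) auto
  also have "EV b \<odot> ?b \<rhd> TW \<odot> E ?b \<odot> b \<rhd> DU F = (EV b \<odot> ?b \<rhd> TW \<odot> E ?b) \<odot> b \<rhd> DU F"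
    using F by simp
  also have "\<dots> = EV ?x \<odot> F \<lhd> ?x"
    using F by (simp only: E_dual_TW EV_slide_right)
  also have "\<dots> = bend_right x \<one>\<^sub>o F"
    using F by (simp add: bend_right_def)
  finally show "bend_left x \<one>\<^sub>o (F \<odot> TW) \<odot> E ?x = bend_right x \<one>\<^sub>o F" .
qed (use F in auto)

text \<open>
  Bending \<open>E x\<close> gives \<open>G : b \<rightarrow> x \<otimes> b \<otimes> dual x\<close>. Rotating \<open>(x \<rhd> TW \<lhd> dual x) \<odot> G\<close> once around,
  one factor at a time, yields \<open>G\<close>; by \<open>rotate_full\<close> so does rotating \<open>G \<odot> TW\<close>.
\<close>

lemma TW_central:
  assumes x [simp]: "x \<in> obj C"
  shows "x \<rhd> TW \<odot> E x = E x \<odot> TW \<lhd> x"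
proof -
  let ?x = "dual C x"
  let ?G = "E x \<lhd> ?x \<odot> b \<rhd> CO x"
  have G [simp]: "arr ?G" "src ?G = b" "tgt ?G = x \<otimes>\<^sub>o b \<otimes>\<^sub>o ?x" by simp_all
  \<comment> \<open>Rotating \<open>x\<close> makes \<open>E ?x\<close> cancel \<open>E x\<close>:
    the strand of \<open>x\<close> comes off \<open>b\<close>, and a free cup \<open>CO ?x\<close>
    is left beside the twisted strand.\<close>
  have 1: "rotate x (b \<otimes>\<^sub>o ?x) (x \<rhd> TW \<lhd> ?x \<odot> ?G) = b \<rhd> CO ?x \<odot> TW"
  proof (rule rotate_eqI)
    have "bend_left x (b \<otimes>\<^sub>o ?x) (x \<rhd> TW \<lhd> ?x \<odot> ?G) \<odot> E ?x
       = (EV x \<lhd> (b \<otimes>\<^sub>o ?x) \<odot> (?x \<otimes>\<^sub>o x) \<rhd> TW \<lhd> ?x) \<odot> ?x \<rhd> E x \<lhd> ?x \<odot> ((?x \<otimes>\<^sub>o b) \<rhd> CO x \<odot> E ?x)"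
      by (simp add: bend_left_def)
    also have "EV x \<lhd> (b \<otimes>\<^sub>o ?x) \<odot> (?x \<otimes>\<^sub>o x) \<rhd> TW \<lhd> ?x = TW \<lhd> ?x \<odot> EV x \<lhd> (b \<otimes>\<^sub>o ?x)"
      using whisker_exchange[of "EV x" "TW \<lhd> ?x"] by simp
    also have "(?x \<otimes>\<^sub>o b) \<rhd> CO x \<odot> E ?x = E ?x \<lhd> (x \<otimes>\<^sub>o ?x) \<odot> (b \<otimes>\<^sub>o ?x) \<rhd> CO x"
      using whisker_exchange[of "E ?x" "CO x"] by simp
    also have "(TW \<lhd> ?x \<odot> EV x \<lhd> (b \<otimes>\<^sub>o ?x)) \<odot> ?x \<rhd> E x \<lhd> ?x \<odot> E ?x \<lhd> (x \<otimes>\<^sub>o ?x) \<odot> (b \<otimes>\<^sub>o ?x) \<rhd> CO x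
       = TW \<lhd> ?x \<odot> (EV x \<lhd> b \<odot> ?x \<rhd> E x \<odot> E ?x \<lhd> x) \<lhd> ?x \<odot> (b \<otimes>\<^sub>o ?x) \<rhd> CO x"
      by simp
    also have "\<dots> = TW \<lhd> ?x \<odot> b \<rhd> (EV x \<lhd> ?x \<odot> ?x \<rhd> CO x)"
      by (subst E_dual_cancel) simp_all
    also have "\<dots> = TW \<lhd> ?x" by (subst zag) simp_all
    also have "\<dots> = b \<rhd> (?x \<rhd> EV ?x \<odot> CO ?x \<lhd> ?x) \<odot> TW \<lhd> ?x"
      by (subst zig) simp_all
    also have "\<dots> = bend_right x (b \<otimes>\<^sub>o ?x) (b \<rhd> CO ?x \<odot> TW)"
      by (simp add: bend_right_def)
    finally show "bend_left x (b \<otimes>\<^sub>o ?x) (x \<rhd> TW \<lhd> ?x \<odot> ?G) \<odot> E ?x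
      = bend_right x (b \<otimes>\<^sub>o ?x) (b \<rhd> CO ?x \<odot> TW)" .
  qed simp_all
  \<comment> \<open>The cup sits on the stationary legs, so \<open>rotate_post\<close> takes it out,
    and \<open>rotate_full\<close> at the identity absorbs \<open>TW\<close>.\<close>
  have 2: "rotate b (?x \<otimes>\<^sub>o x) (b \<rhd> CO ?x \<odot> TW) = CO ?x \<lhd> b"
    using rotate_post[of TW b "\<one>\<^sub>o" "CO ?x"] rotate_full[of "idn b" b] by simp
  \<comment> \<open>Rotating \<open>?x\<close> pulls the cup around \<open>b\<close> and recreates
    the crossing, now without a twist.\<close>
  have 3: "rotate ?x (x \<otimes>\<^sub>o b) (CO ?x \<lhd> b) = ?G"
  proof (rule rotate_eqI)
    have "bend_left ?x (x \<otimes>\<^sub>o b) (CO ?x \<lhd> b) \<odot> E (dual C ?x)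
       = (EV ?x \<lhd> dual C ?x \<odot> dual C ?x \<rhd> CO ?x) \<lhd> b \<odot> E x"
      by (simp add: bend_left_def)
    also have "\<dots> = E x" by (subst zag) simp_all
    finally have 1: "bend_left ?x (x \<otimes>\<^sub>o b) (CO ?x \<lhd> b) \<odot> E (dual C ?x) = E x" .
    have "bend_right ?x (x \<otimes>\<^sub>o b) ?G = ((x \<otimes>\<^sub>o b) \<rhd> EV x \<odot> E x \<lhd> (?x \<otimes>\<^sub>o x)) \<odot> b \<rhd> CO x \<lhd> x"
      by (simp add: bend_right_def)
    also have "(x \<otimes>\<^sub>o b) \<rhd> EV x \<odot> E x \<lhd> (?x \<otimes>\<^sub>o x) = E x \<odot> (b \<otimes>\<^sub>o x) \<rhd> EV x"
      using whisker_exchange[of "E x" "EV x"] by simp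
    also have "\<dots> \<odot> b \<rhd> CO x \<lhd> x = E x \<odot> b \<rhd> (x \<rhd> EV x \<odot> CO x \<lhd> x)"
      by simp
    also have "\<dots> = E x" by (subst zig) simp_all
    finally show "bend_left ?x (x \<otimes>\<^sub>o b) (CO ?x \<lhd> b) \<odot> E (dual C ?x) = bend_right ?x (x \<otimes>\<^sub>o b) ?G"
      using 1 by simp
  qed simp_all
  have "rotate (x \<otimes>\<^sub>o b \<otimes>\<^sub>o ?x) \<one>\<^sub>o (x \<rhd> TW \<lhd> ?x \<odot> ?G)
      = rotate ?x (x \<otimes>\<^sub>o b) (rotate b (?x \<otimes>\<^sub>o x) (rotate x (b \<otimes>\<^sub>o ?x) (x \<rhd> TW \<lhd> ?x \<odot> ?G)))"
    using rotate_tens[of "x \<rhd> TW \<lhd> ?x \<odot> ?G" x "b \<otimes>\<^sub>o ?x" "\<one>\<^sub>o"]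
      rotate_tens[of "rotate x (b \<otimes>\<^sub>o ?x) (x \<rhd> TW \<lhd> ?x \<odot> ?G)" b ?x x]
    by simp
  also have "\<dots> = ?G" by (simp only: 1 2 3)
  also have "\<dots> = rotate (x \<otimes>\<^sub>o b \<otimes>\<^sub>o ?x) \<one>\<^sub>o (?G \<odot> TW)"
    by (rule rotate_full[symmetric]) simp_all
  finally have "x \<rhd> TW \<lhd> ?x \<odot> ?G = ?G \<odot> TW"
    by (rule rotate_inj[rotated -1]) simp_all
  \<comment> \<open>Bending the last leg of \<open>?G\<close> down again recovers
    \<open>E x\<close>, with the twist on either side carried along.\<close>
  then have eq: "bend_right ?x (x \<otimes>\<^sub>o b) (x \<rhd> TW \<lhd> ?x \<odot> ?G) = bend_right ?x (x \<otimes>\<^sub>o b) (?G \<odot> TW)"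
    by simp
  have bG: "bend_right ?x (x \<otimes>\<^sub>o b) ?G = E x"
    using bend_right_unbend[of "E x" ?x b] by simp
  have "bend_right ?x (x \<otimes>\<^sub>o b) (?G \<odot> TW) = bend_right ?x (x \<otimes>\<^sub>o b) ?G \<odot> TW \<lhd> x"
    by (simp add: bend_right_def)
  moreover have "bend_right ?x (x \<otimes>\<^sub>o b) (x \<rhd> TW \<lhd> ?x \<odot> ?G)
      = ((x \<otimes>\<^sub>o b) \<rhd> EV x \<odot> (x \<rhd> TW) \<lhd> (?x \<otimes>\<^sub>o x)) \<odot> ?G \<lhd> x"
    by (simp add: bend_right_def)
  moreover have "(x \<otimes>\<^sub>o b) \<rhd> EV x \<odot> (x \<rhd> TW) \<lhd> (?x \<otimes>\<^sub>o x) = x \<rhd> TW \<odot> (x \<otimes>\<^sub>o b) \<rhd> EV x"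
    using whisker_exchange[of "x \<rhd> TW" "EV x"] by simp
  moreover have "(x \<rhd> TW \<odot> (x \<otimes>\<^sub>o b) \<rhd> EV x) \<odot> ?G \<lhd> x = x \<rhd> TW \<odot> bend_right ?x (x \<otimes>\<^sub>o b) ?G"
    by (simp add: bend_right_def)
  ultimately show ?thesis using eq by (simp only: bG)
qed

end

section \<open>Powers of the rotation operator\<close>

context half_braided_object
begin

lemma rotate_add:
  assumes "arr S" "arr T" "x \<in> obj C" "y \<in> obj C" "src S = b" "tgt S = x \<otimes>\<^sub>o y" "src T = b" "tgt T = x \<otimes>\<^sub>o y"
  shows "rotate x y (S \<oplus> T) = rotate x y S \<oplus> rotate x y T"
  using assms by (simp add: rotate_def bend_left_def)

lemma rotate_scl:
  assumes "arr S" "x \<in> obj C" "y \<in> obj C" "src S = b" "tgt S = x \<otimes>\<^sub>o y"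
  shows "rotate x y (c \<bullet> S) = c \<bullet> rotate x y S"
  using assms by (simp add: rotate_def bend_left_def)

text \<open>\<open>tens_pow\<close> adds factors on the left, so the first \<open>a\<close> is moved
  to the end; strictness identifies the new target \<open>tens_pow C a n \<otimes>\<^sub>o a\<close>
  with the old one.\<close>

lemma rotate_rot:
  assumes a: "a \<in> obj C" and f: "f \<in> hom C b (tens_pow C a (Suc n))"
  shows "rotate a (tens_pow C a n) (Arrow b f (tens_pow C a (Suc n)))
    = Arrow b (rot C (b, e) (Suc n) a f) (tens_pow C a (Suc n))"
proof -
  let ?S = "Arrow b f (tens_pow C a (Suc n))" and ?a = "dual C a"
  have S: "arr ?S" using a f by (simp add: arr_Arrow)
  have comm: "tens_pow C a n \<otimes>\<^sub>o a = tens_pow C a (Suc n)"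
    using tens_pow_add[OF a, of n 1] a by simp
  have "rotate a (tens_pow C a n) ?S
    = ((EV a \<lhd> (tens_pow C a n \<otimes>\<^sub>o a) \<odot> ?a \<rhd> (?S \<lhd> a)) \<odot> E ?a \<lhd> a) \<odot> b \<rhd> CO ?a"
    using S a by (simp add: rotate_def bend_left_def)
  also have "\<dots> = Arrow b (rot C (b, e) (Suc n) a f) (tens_pow C a (Suc n))"
    unfolding comm using a by (simp add: rot.simps EV_def CO_def E_def lw_def rw_def cmp_def)
  finally show ?thesis .
qed

text \<open>By \<open>rotate_tens\<close>, moving \<open>k\<close> factors one at a time is moving
  the block of the first \<open>k\<close>. The case of interest is \<open>m = 0\<close>, the full
  rotation.\<close>

lemma rotate_funpow:
  assumes a: "a \<in> obj C" and f: "f \<in> hom C b (tens_pow C a n)" and "k + m = n"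
  shows "rotate (tens_pow C a k) (tens_pow C a m) (Arrow b f (tens_pow C a n))
    = Arrow b ((rot C (b, e) n a ^^ k) f) (tens_pow C a n)"
  using assms(3)
proof (induction k arbitrary: m)
  case 0
  let ?S = "Arrow b f (tens_pow C a n)"
  have S: "arr ?S" using a f by (simp add: arr_Arrow)
  \<comment> \<open>Cap, cup and half-braiding are all identities at the unit, so moving an empty
    block does nothing.\<close>
  have "EV \<one>\<^sub>o = idn \<one>\<^sub>o" "CO \<one>\<^sub>o = idn \<one>\<^sub>o"
    by (simp_all add: EV_def CO_def idn_def ev_unit coev_unit unit_obj)
  then show ?case using S a 0 by (simp add: rotate_def bend_left_def E_unit)
next
  case (Suc k)
  let ?S = "Arrow b f (tens_pow C a n)"
  let ?g = "(rot C (b, e) n a ^^ k) f"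
  obtain n' where n': "n = Suc n'" using Suc.prems by (cases n) auto
  have S: "arr ?S" "tgt ?S = tens_pow C a k \<otimes>\<^sub>o a \<otimes>\<^sub>o tens_pow C a m"
    using a f Suc.prems tens_pow_add[OF a, of k "Suc m"] by (simp_all add: arr_Arrow)
  have IH: "rotate (tens_pow C a k) (a \<otimes>\<^sub>o tens_pow C a m) ?S = Arrow b ?g (tens_pow C a n)"
    using Suc.IH[of "Suc m"] Suc.prems by simp
  have "arr (rotate (tens_pow C a k) (a \<otimes>\<^sub>o tens_pow C a m) ?S)"
    by (rule rotate_simps) (use S a in simp_all)
  then have g: "?g \<in> hom C b (tens_pow C a n)"
    unfolding IH arr_Arrow by blast
  \<comment> \<open>Besides the factor moved next, \<open>m\<close> factors still wait and
    \<open>k\<close> have been moved; together they are \<open>n' = n - 1\<close>.\<close>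
  have n'_eq: "tens_pow C a m \<otimes>\<^sub>o tens_pow C a k = tens_pow C a n'"
    using tens_pow_add[OF a, of m k] Suc.prems n' by (simp add: add.commute)
  have "tens_pow C a (Suc k) = tens_pow C a k \<otimes>\<^sub>o a"
    using tens_pow_add[OF a, of k 1] a by simp
  then have "rotate (tens_pow C a (Suc k)) (tens_pow C a m) ?S
      = rotate a (tens_pow C a n') (Arrow b ?g (tens_pow C a n))"
    using rotate_tens[of ?S "tens_pow C a k" a "tens_pow C a m"] S a IH n'_eq
    by (simp only: arrow.sel tens_pow_obj)
  then show ?case
    using rotate_rot[OF a, of ?g n'] g n' by (simp del: tens_pow.simps)
qed

lemma rot_in:
  assumes "a \<in> obj C" "f \<in> hom C b (tens_pow C a n)" "n \<ge> 1"
  shows "rot C (b, e) n a f \<in> hom C b (tens_pow C a n)"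
proof -
  obtain n' where n': "n = Suc n'" using assms by (cases n) auto
  have "arr (rotate a (tens_pow C a n') (Arrow b f (tens_pow C a n)))"
    using assms n' by (intro rotate_simps) (auto simp: arr_Arrow)
  then show ?thesis using rotate_rot[of a f n'] assms n' by (simp add: arr_Arrow)
qed

lemma rot_linear:
  assumes a: "a \<in> obj C" and f: "f \<in> hom C b (tens_pow C a n)" and g: "g \<in> hom C b (tens_pow C a n)" and "n \<ge> 1"
  shows "rot C (b, e) n a (f + g) = rot C (b, e) n a f + rot C (b, e) n a g"
    and "rot C (b, e) n a (smult C c f) = smult C c (rot C (b, e) n a f)"
proof -
  obtain n' where n': "n = Suc n'" using assms by (cases n) auto
  let ?A = "\<lambda>f. Arrow b f (tens_pow C a n)" and ?r = "rotate a (tens_pow C a n')"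
  have V: "subspace (hom C b (tens_pow C a n))" using a by (intro hom_subspace) auto
  have r: "mor (?r (?A h)) = rot C (b, e) n a h" if "h \<in> hom C b (tens_pow C a n)" for h
    using rotate_rot[OF a, of h n'] that n' by (simp)
  have "?A (f + g) = ?A f \<oplus> ?A g" "?A (smult C c f) = c \<bullet> ?A f" by (simp_all add: add_def scl_def)
  moreover have "?r (?A f \<oplus> ?A g) = ?r (?A f) \<oplus> ?r (?A g)" "?r (c \<bullet> ?A f) = c \<bullet> ?r (?A f)"
    using assms n' by (intro rotate_add rotate_scl; simp add: arr_Arrow)+
  ultimately show "rot C (b, e) n a (f + g) = rot C (b, e) n a f + rot C (b, e) n a g"
    and "rot C (b, e) n a (smult C c f) = smult C c (rot C (b, e) n a f)"
    using r[OF f] r[OF g] r[OF subspace_add[OF V f g]] r[OF subspace_scale[OF V f]]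
    by (metis src_tgt_linear(3), metis src_tgt_linear(6))
qed

lemma mor_TW: "mor TW = twist C (b, e)"
proof -
  have "TW = (b \<rhd> EV (dual C b) \<odot> E b \<lhd> dual C b) \<odot> b \<rhd> CO b" by (simp add: TW_def)
  then show ?thesis by (simp add: twist.simps EV_def CO_def E_def lw_def rw_def cmp_def)
qed

text \<open>Combines \<open>rotate_full\<close> with \<open>rotate_funpow\<close> at
  \<open>k = n\<close>, \<open>m = 0\<close>. The scalar stays on the argument, so its invertibility
  is not presupposed.\<close>

lemma rot_funpow_twist:
  assumes a: "a \<in> obj C" and f: "f \<in> hom C b (tens_pow C a n)" and c: "twist C (b, e) = smult C c (\<i>\<d> b)"
  shows "(rot C (b, e) n a ^^ n) (smult C c f) = f"
proof -
  let ?S = "Arrow b f (tens_pow C a n)"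
  have S: "arr ?S" using a f by (simp add: arr_Arrow)
  have TW: "TW = c \<bullet> idn b"
    using c by (intro arrow.expand) (simp add: mor_TW idn_def)
  have "?S \<odot> TW = c \<bullet> ?S" unfolding TW using S by simp
  then have "?S = rotate (tens_pow C a n) \<one>\<^sub>o (c \<bullet> ?S)"
    using rotate_full[of ?S] S by simp
  also have "\<dots> = Arrow b ((rot C (b, e) n a ^^ n) (smult C c f)) (tens_pow C a n)"
    using rotate_funpow[OF a, of "smult C c f" n n 0] f a subspace_scale[OF hom_subspace, of b "tens_pow C a n" f c]
    by (simp add: scl_def)
  finally show ?thesis by simp
qed

text \<open>Rotation is linear and takes \<open>TW\<close> to the identity of \<open>b\<close>, so
  \<open>TW\<close> cannot be zero.\<close>

lemma twist_nonzero:
  assumes "\<i>\<d> b \<noteq> 0"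
  shows "twist C (b, e) \<noteq> 0"
proof
  assume "twist C (b, e) = 0"
  then have "TW = 0 \<bullet> TW" by (intro zero_arrow) (simp add: mor_TW)
  moreover have "rotate b \<one>\<^sub>o TW = idn b" using rotate_full[of "idn b"] by simp
  moreover have "rotate b \<one>\<^sub>o (0 \<bullet> TW) = 0 \<bullet> rotate b \<one>\<^sub>o TW" by (rule rotate_scl) simp_all
  ultimately have "mor (idn b) = mor (0 \<bullet> idn b)" by metis
  then show False using assms by (simp add: idn_def)
qed

end

text \<open>
  The kernel \<open>K\<close> of a central endomorphism \<open>U\<close> inherits a half-braiding: since objects have duals,
  tensoring with an object preserves kernels, so \<open>E x\<close> restricts along \<open>K\<close>.
\<close>

locale central_endo_kernel = half_braided_object +
  fixes U K
  assumes U [simp]: "arr U" "src U = b" "tgt U = b"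
    and U_central: "x \<in> obj C \<Longrightarrow> x \<rhd> U \<odot> E x = E x \<odot> U \<lhd> x"
    and K [simp]: "arr K" "tgt K = b"
    and UK: "mor (U \<odot> K) = 0"
    and K_factor: "arr G \<Longrightarrow> tgt G = b \<Longrightarrow> mor (U \<odot> G) = 0 \<Longrightarrow> \<exists>H. arr H \<and> src H = src G \<and> tgt H = src K \<and> K \<odot> H = G"
    and K_mono: "arr H \<Longrightarrow> arr H' \<Longrightarrow> src H = src H' \<Longrightarrow> tgt H = src K \<Longrightarrow> tgt H' = src K \<Longrightarrow> K \<odot> H = K \<odot> H' \<Longrightarrow> H = H'"
begin

abbreviation "w \<equiv> src K"

section \<open>Tensoring preserves the kernel\<close>

text \<open>Bending moves \<open>x\<close> from the target to the source. There the hypothesis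
  becomes \<open>mor (U \<odot> ?G) = 0\<close>, the universal property of \<open>K\<close> gives a
  factor \<open>L\<close>, and unbending \<open>L\<close> gives \<open>H\<close>.\<close>

lemma lw_K_factor:
  assumes [simp]: "x \<in> obj C" "arr G" "tgt G = x \<otimes>\<^sub>o b" and z: "mor (x \<rhd> U \<odot> G) = 0"
  shows "\<exists>H. arr H \<and> src H = src G \<and> tgt H = x \<otimes>\<^sub>o w \<and> x \<rhd> K \<odot> H = G"
proof -
  let ?G = "bend_left x b G"
  have G [simp]: "arr ?G" "src ?G = dual C x \<otimes>\<^sub>o src G" "tgt ?G = b" by (simp_all add: bend_left_def)
  have "U \<odot> ?G = (U \<odot> EV x \<lhd> b) \<odot> dual C x \<rhd> G"
    by (simp add: bend_left_def)
  also have "U \<odot> EV x \<lhd> b = EV x \<lhd> b \<odot> (dual C x \<otimes>\<^sub>o x) \<rhd> U"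
    using whisker_exchange[of "EV x" U] by simp
  also have "\<dots> \<odot> dual C x \<rhd> G = EV x \<lhd> b \<odot> dual C x \<rhd> (x \<rhd> U \<odot> G)" by simp
  also have "mor \<dots> = 0"
    by (rule mor_cmp_zero) (use z in \<open>simp_all add: mor_whisker_zero del: whisker_cmp\<close>)
  finally obtain L where L: "arr L" "src L = dual C x \<otimes>\<^sub>o src G" "tgt L = w" "K \<odot> L = ?G"
    using K_factor[of ?G] by auto
  have "x \<rhd> K \<odot> (x \<rhd> L \<odot> CO x \<lhd> src G) = x \<rhd> (K \<odot> L) \<odot> CO x \<lhd> src G" using L(1-3) by simp
  also have "\<dots> = G" unfolding L(4) by (rule unbend_left) simp_all
  finally show ?thesis using L(1-3) by (intro exI[of _ "x \<rhd> L \<odot> CO x \<lhd> src G"]) simp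
qed

lemma lw_K_mono:
  assumes "x \<in> obj C" "arr H" "arr H'" "src H = src H'" "tgt H = x \<otimes>\<^sub>o w" "tgt H' = x \<otimes>\<^sub>o w"
    and eq: "x \<rhd> K \<odot> H = x \<rhd> K \<odot> H'"
  shows "H = H'"
proof -
  have *: "K \<odot> bend_left x w J = bend_left x b (x \<rhd> K \<odot> J)" if "arr J" "tgt J = x \<otimes>\<^sub>o w" for J
  proof -
    have "bend_left x b (x \<rhd> K \<odot> J) = (EV x \<lhd> b \<odot> (dual C x \<otimes>\<^sub>o x) \<rhd> K) \<odot> dual C x \<rhd> J"
      using that assms(1) by (simp add: bend_left_def)
    also have "EV x \<lhd> b \<odot> (dual C x \<otimes>\<^sub>o x) \<rhd> K = K \<odot> EV x \<lhd> w"
      using whisker_exchange[of "EV x" K] assms(1) by simp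
    finally show ?thesis using that assms(1) by (simp add: bend_left_def)
  qed
  have "bend_left x w H = bend_left x w H'"
    by (rule K_mono) (use assms *[of H] *[of H'] in simp_all)
  then show ?thesis using unbend_left[of H x w] unbend_left[of H' x w] assms(1-6) arr_obj(1)[OF K(1)] by metis
qed

text \<open>As \<open>lw_K_factor\<close>, with the leg bent to the right; serves to restrict the
  inverse of \<open>E x\<close>.\<close>

lemma rw_K_factor:
  assumes [simp]: "x \<in> obj C" "arr G" "tgt G = b \<otimes>\<^sub>o x" and z: "mor (U \<lhd> x \<odot> G) = 0"
  shows "\<exists>H. arr H \<and> src H = src G \<and> tgt H = w \<otimes>\<^sub>o x \<and> K \<lhd> x \<odot> H = G"
proof -
  let ?G = "bend_right x b G"
  have G [simp]: "arr ?G" "src ?G = src G \<otimes>\<^sub>o dual C x" "tgt ?G = b" by (simp_all add: bend_right_def)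
  have "U \<odot> ?G = (U \<odot> b \<rhd> EV (dual C x)) \<odot> G \<lhd> dual C x"
    by (simp add: bend_right_def)
  also have "U \<odot> b \<rhd> EV (dual C x) = b \<rhd> EV (dual C x) \<odot> U \<lhd> (x \<otimes>\<^sub>o dual C x)"
    using whisker_exchange[of U "EV (dual C x)"] by simp
  also have "\<dots> \<odot> G \<lhd> dual C x = b \<rhd> EV (dual C x) \<odot> (U \<lhd> x \<odot> G) \<lhd> dual C x" by simp
  also have "mor \<dots> = 0"
    by (rule mor_cmp_zero) (use z in \<open>simp_all add: mor_whisker_zero del: whisker_cmp\<close>)
  finally obtain L where L: "arr L" "src L = src G \<otimes>\<^sub>o dual C x" "tgt L = w" "K \<odot> L = ?G"
    using K_factor[of ?G] by auto
  have "K \<lhd> x \<odot> (L \<lhd> x \<odot> src G \<rhd> CO (dual C x)) = (K \<odot> L) \<lhd> x \<odot> src G \<rhd> CO (dual C x)"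
    using L(1-3) by simp
  also have "\<dots> = G" unfolding L(4) by (rule unbend_right) simp_all
  finally show ?thesis using L(1-3) by (intro exI[of _ "L \<lhd> x \<odot> src G \<rhd> CO (dual C x)"]) simp
qed

lemma rw_K_mono:
  assumes "x \<in> obj C" "arr H" "arr H'" "src H = src H'" "tgt H = w \<otimes>\<^sub>o x" "tgt H' = w \<otimes>\<^sub>o x"
    and eq: "K \<lhd> x \<odot> H = K \<lhd> x \<odot> H'"
  shows "H = H'"
proof -
  let ?x = "dual C x"
  have *: "K \<odot> bend_right x w J = bend_right x b (K \<lhd> x \<odot> J)" if "arr J" "tgt J = w \<otimes>\<^sub>o x" for J
  proof -
    have "bend_right x b (K \<lhd> x \<odot> J) = (b \<rhd> EV ?x \<odot> K \<lhd> (x \<otimes>\<^sub>o ?x)) \<odot> J \<lhd> ?x"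
      using that assms(1) by (simp add: bend_right_def)
    also have "b \<rhd> EV ?x \<odot> K \<lhd> (x \<otimes>\<^sub>o ?x) = K \<odot> w \<rhd> EV ?x"
      using whisker_exchange[of K "EV ?x"] assms(1) by simp
    finally show ?thesis using that assms(1) by (simp add: bend_right_def)
  qed
  have "bend_right x w H = bend_right x w H'"
    by (rule K_mono) (use assms *[of H] *[of H'] in simp_all)
  then show ?thesis using unbend_right[of H x w] unbend_right[of H' x w] assms(1-6) arr_obj(1)[OF K(1)] by metis
qed

section \<open>The half-braiding induced on the kernel\<close>

text \<open>The restriction of \<open>E x\<close> along \<open>K\<close>. By
  \<open>lw_K_mono\<close> the choice is unique, and naturality and tensor compatibility can be
  tested after composing with a whiskered \<open>K\<close>.\<close>

definition E' where
  "E' x = (SOME H. arr H \<and> src H = w \<otimes>\<^sub>o x \<and> tgt H = x \<otimes>\<^sub>o w \<and> x \<rhd> K \<odot> H = E x \<odot> K \<lhd> x)"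

lemma E':
  assumes [simp]: "x \<in> obj C"
  shows "arr (E' x) \<and> src (E' x) = w \<otimes>\<^sub>o x \<and> tgt (E' x) = x \<otimes>\<^sub>o w \<and> x \<rhd> K \<odot> E' x = E x \<odot> K \<lhd> x"
proof -
  \<comment> \<open>\<open>U\<close> passes \<open>E x\<close> by centrality and then meets
    \<open>K\<close>, so \<open>E x \<odot> K \<lhd> x\<close> is killed by
    \<open>x \<rhd> U\<close> and factors.\<close>
  have "x \<rhd> U \<odot> (E x \<odot> K \<lhd> x) = (x \<rhd> U \<odot> E x) \<odot> K \<lhd> x" by simp
  also have "\<dots> = E x \<odot> (U \<odot> K) \<lhd> x" unfolding U_central[OF assms] by simp
  also have "mor \<dots> = 0"
    by (rule mor_cmp_zero) (use UK in \<open>simp_all add: mor_whisker_zero del: whisker_cmp\<close>)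
  finally have "\<exists>H. arr H \<and> src H = w \<otimes>\<^sub>o x \<and> tgt H = x \<otimes>\<^sub>o w \<and> x \<rhd> K \<odot> H = E x \<odot> K \<lhd> x"
    using lw_K_factor[of x "E x \<odot> K \<lhd> x"] by simp
  then show ?thesis unfolding E'_def by (rule someI_ex)
qed

lemma E'_simps [simp]:
  "x \<in> obj C \<Longrightarrow> arr (E' x)" "x \<in> obj C \<Longrightarrow> src (E' x) = w \<otimes>\<^sub>o x" "x \<in> obj C \<Longrightarrow> tgt (E' x) = x \<otimes>\<^sub>o w"
  using E' by auto

lemma K_E': "x \<in> obj C \<Longrightarrow> x \<rhd> K \<odot> E' x = E x \<odot> K \<lhd> x"
  using E' by auto

text \<open>The inverse \<open>G\<close> of \<open>E x\<close> also commutes with \<open>U\<close>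
  and so restricts to some \<open>D\<close>; the two restrictions are mutually inverse because
  \<open>K\<close> whiskered on either side can be cancelled.\<close>

lemma E'_inverse:
  assumes [simp]: "x \<in> obj C"
  shows "\<exists>D. arr D \<and> src D = x \<otimes>\<^sub>o w \<and> tgt D = w \<otimes>\<^sub>o x \<and> D \<odot> E' x = idn (w \<otimes>\<^sub>o x) \<and> E' x \<odot> D = idn (x \<otimes>\<^sub>o w)"
proof -
  obtain G where G [simp]: "arr G" "src G = x \<otimes>\<^sub>o b" "tgt G = b \<otimes>\<^sub>o x"
    and GE: "G \<odot> E x = idn (b \<otimes>\<^sub>o x)" and EG: "E x \<odot> G = idn (x \<otimes>\<^sub>o b)"
    using E_inverse[of x] by auto
  have "U \<lhd> x \<odot> G = (G \<odot> E x) \<odot> U \<lhd> x \<odot> G" unfolding GE by simp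
  also have "\<dots> = G \<odot> (E x \<odot> U \<lhd> x) \<odot> G" by simp
  also have "\<dots> = G \<odot> x \<rhd> U \<odot> (E x \<odot> G)" unfolding U_central[OF assms, symmetric] by simp
  also have "\<dots> = G \<odot> x \<rhd> U" unfolding EG by simp
  finally have UG: "U \<lhd> x \<odot> G = G \<odot> x \<rhd> U" .
  have "U \<lhd> x \<odot> (G \<odot> x \<rhd> K) = (U \<lhd> x \<odot> G) \<odot> x \<rhd> K" by simp
  also have "\<dots> = G \<odot> x \<rhd> (U \<odot> K)" unfolding UG by simp
  also have "mor \<dots> = 0"
    by (rule mor_cmp_zero) (use UK in \<open>simp_all add: mor_whisker_zero del: whisker_cmp\<close>)
  finally obtain D where D [simp]: "arr D" "src D = x \<otimes>\<^sub>o w" "tgt D = w \<otimes>\<^sub>o x"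
    and KD: "K \<lhd> x \<odot> D = G \<odot> x \<rhd> K"
    using rw_K_factor[of x "G \<odot> x \<rhd> K"] by auto
  have "K \<lhd> x \<odot> (D \<odot> E' x) = (K \<lhd> x \<odot> D) \<odot> E' x" by simp
  also have "\<dots> = G \<odot> (x \<rhd> K \<odot> E' x)" unfolding KD by simp
  also have "\<dots> = (G \<odot> E x) \<odot> K \<lhd> x" unfolding K_E'[OF assms] by simp
  also have "\<dots> = K \<lhd> x \<odot> idn (w \<otimes>\<^sub>o x)" unfolding GE by simp
  finally have 1: "D \<odot> E' x = idn (w \<otimes>\<^sub>o x)" by (rule rw_K_mono[rotated -1]) simp_all
  have "x \<rhd> K \<odot> (E' x \<odot> D) = (x \<rhd> K \<odot> E' x) \<odot> D" by simp
  also have "\<dots> = E x \<odot> (K \<lhd> x \<odot> D)" unfolding K_E'[OF assms] by simp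
  also have "\<dots> = (E x \<odot> G) \<odot> x \<rhd> K" unfolding KD by simp
  also have "\<dots> = x \<rhd> K \<odot> idn (x \<otimes>\<^sub>o w)" unfolding EG by simp
  finally have 2: "E' x \<odot> D = idn (x \<otimes>\<^sub>o w)" by (rule lw_K_mono[rotated -1]) simp_all
  show ?thesis using 1 2 by (intro exI[of _ D]) simp
qed

lemma E'_natural:
  assumes F [simp]: "arr F" "src F = x" "tgt F = y"
  shows "F \<lhd> w \<odot> E' x = E' y \<odot> w \<rhd> F"
proof -
  have [simp]: "x \<in> obj C" "y \<in> obj C" using arr_obj[OF F(1)] by simp_all
  have "y \<rhd> K \<odot> (F \<lhd> w \<odot> E' x) = (y \<rhd> K \<odot> F \<lhd> w) \<odot> E' x" by simp
  also have "y \<rhd> K \<odot> F \<lhd> w = F \<lhd> b \<odot> x \<rhd> K" using whisker_exchange[of F K] by simp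
  also have "(F \<lhd> b \<odot> x \<rhd> K) \<odot> E' x = F \<lhd> b \<odot> (x \<rhd> K \<odot> E' x)" by simp
  also have "\<dots> = (F \<lhd> b \<odot> E x) \<odot> K \<lhd> x" by (simp add: K_E')
  also have "F \<lhd> b \<odot> E x = E y \<odot> b \<rhd> F" by (rule E_natural) simp_all
  also have "(E y \<odot> b \<rhd> F) \<odot> K \<lhd> x = E y \<odot> (b \<rhd> F \<odot> K \<lhd> x)" by simp
  also have "b \<rhd> F \<odot> K \<lhd> x = K \<lhd> y \<odot> w \<rhd> F" using whisker_exchange[of K F] by simp
  also have "E y \<odot> \<dots> = (E y \<odot> K \<lhd> y) \<odot> w \<rhd> F" by simp
  also have "\<dots> = y \<rhd> K \<odot> (E' y \<odot> w \<rhd> F)" unfolding K_E'[OF \<open>y \<in> obj C\<close>, symmetric] by simp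
  finally show ?thesis by (rule lw_K_mono[rotated -1]) simp_all
qed

lemma E'_tens:
  assumes [simp]: "x \<in> obj C" "y \<in> obj C"
  shows "E' (x \<otimes>\<^sub>o y) = x \<rhd> E' y \<odot> E' x \<lhd> y"
proof -
  have "(x \<otimes>\<^sub>o y) \<rhd> K \<odot> E' (x \<otimes>\<^sub>o y) = x \<rhd> E y \<odot> (E x \<odot> K \<lhd> x) \<lhd> y"
    by (simp add: K_E' E_tens)
  also have "\<dots> = x \<rhd> (E y \<odot> K \<lhd> y) \<odot> E' x \<lhd> y"
    unfolding K_E'[OF assms(1), symmetric] by simp
  also have "\<dots> = (x \<otimes>\<^sub>o y) \<rhd> K \<odot> (x \<rhd> E' y \<odot> E' x \<lhd> y)"
    unfolding K_E'[OF assms(2), symmetric] by simp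
  finally show ?thesis by (rule lw_K_mono[rotated -1]) simp_all
qed

lemma half_braiding_kernel: "half_braiding C w (\<lambda>x. mor (E' x))"
proof -
  have E'_Arrow: "E' x = Arrow (w \<otimes>\<^sub>o x) (mor (E' x)) (x \<otimes>\<^sub>o w)" if "x \<in> obj C" for x
    using that by (intro arrow.expand) simp
  have "is_iso C (w \<otimes>\<^sub>o x) (x \<otimes>\<^sub>o w) (mor (E' x))" if x: "x \<in> obj C" for x
  proof -
    obtain D where "arr D" "src D = x \<otimes>\<^sub>o w" "tgt D = w \<otimes>\<^sub>o x"
      "D \<odot> E' x = idn (w \<otimes>\<^sub>o x)" "E' x \<odot> D = idn (x \<otimes>\<^sub>o w)"
      using E'_inverse[OF x] by blast
    moreover have "arr (E' x)" using x by simp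
    ultimately show ?thesis
      using x E'_simps(2,3)[OF x] unfolding is_iso_def arr_def cmp_def idn_def by auto
  qed
  moreover have "(f \<otimes>\<^sub>m \<i>\<d> w) \<cdot> mor (E' x) = mor (E' y) \<cdot> (\<i>\<d> w \<otimes>\<^sub>m f)"
    if "x \<in> obj C" "y \<in> obj C" "f \<in> hom C x y" for x y f
    using E'_natural[of "Arrow x f y"] that by (simp add: arr_Arrow cmp_def lw_def rw_def)
  moreover have "mor (E' (x \<otimes>\<^sub>o y)) = (\<i>\<d> x \<otimes>\<^sub>m mor (E' y)) \<cdot> (mor (E' x) \<otimes>\<^sub>m \<i>\<d> y)"
    if "x \<in> obj C" "y \<in> obj C" for x y
    using E'_tens that by (simp add: cmp_def lw_def rw_def)
  ultimately show ?thesis by (simp add: half_braiding_def)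
qed

lemma kernel_hom_center: "mor K \<in> hom (center C) (w, \<lambda>x. mor (E' x)) (b, e)"
proof -
  have "(\<i>\<d> x \<otimes>\<^sub>m mor K) \<cdot> mor (E' x) = e x \<cdot> (mor K \<otimes>\<^sub>m \<i>\<d> x)" if "x \<in> obj C" for x
    using K_E'[OF that] by (simp add: cmp_def lw_def rw_def E_def)
  moreover have "mor K \<in> hom C w b" using K unfolding arr_def by auto
  ultimately show ?thesis by (simp add: center_def)
qed

end

section \<open>Endomorphisms of simple objects of the center\<close>

text \<open>Schur's lemma for the center. An eigenvalue \<open>c\<close> comes from left
  multiplication by \<open>mor T\<close> on \<open>hom C b b\<close>; the kernel of
  \<open>T - c\<close> is nonzero and lifts to a subobject in the center, so by simplicity it is
  everything.\<close>

lemma (in half_braided_object) central_endo_scalar: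
  assumes kernels: "\<And>f. f \<in> hom C b b \<Longrightarrow> \<exists>w\<in>obj C. \<exists>k. is_kernel C w b b k f"
    and fin: "\<exists>B. finite B \<and> hom C b b = span B"
    and simple: "simple_obj (center C) (b, e)"
    and T [simp]: "arr T" "src T = b" "tgt T = b"
    and T_central: "\<And>x. x \<in> obj C \<Longrightarrow> x \<rhd> T \<odot> E x = E x \<odot> T \<lhd> x"
  shows "\<exists>c. mor T = smult C c (\<i>\<d> b)"
proof -
  interpret V: finite_dim_subspace "smult C" "hom C b b"
    using fin by unfold_locales
  have T_hom: "mor T \<in> hom C b b" using T unfolding arr_def by simp
  have id_nz: "\<i>\<d> b \<noteq> 0" using simple by (simp add: simple_obj_def center_def)
  have "V.endo (\<lambda>h. mor T \<cdot> h)"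
    unfolding V.endo_def using T_hom comp_hom[of b b b] comp_add_right[of b b b] comp_smult_right[of b b b] by simp
  then obtain c h where h: "h \<in> hom C b b" "h \<noteq> 0" "mor T \<cdot> h = smult C c h"
    using V.eigenvector_exists[of "\<lambda>h. mor T \<cdot> h" "\<i>\<d> b"] ident_hom[OF b_obj] id_nz
      fundamental_theorem_of_algebra by (auto simp: constant_degree)
  define U where "U = T \<oplus> (- c) \<bullet> idn b"
  have U [simp]: "arr U" "src U = b" "tgt U = b" by (simp_all add: U_def)
  have mor_U: "mor U = mor T - smult C c (\<i>\<d> b)" by (simp add: U_def idn_def)
  have "mor U \<in> hom C b b" using U unfolding arr_def by simp
  then obtain w k where w [simp]: "w \<in> obj C" and k: "is_kernel C w b b k (mor U)"
    using kernels by blast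
  have k_hom: "k \<in> hom C w b" and Uk: "mor U \<cdot> k = 0"
    and k_uniq: "\<And>v g. v \<in> obj C \<Longrightarrow> g \<in> hom C v b \<Longrightarrow> mor U \<cdot> g = 0 \<Longrightarrow> \<exists>!h. h \<in> hom C v w \<and> k \<cdot> h = g"
    using k by (auto simp: is_kernel_def)
  define K where "K = Arrow w k b"
  have K [simp]: "arr K" "src K = w" "tgt K = b" using k_hom by (simp_all add: K_def arr_Arrow)
  have UK: "mor (U \<odot> K) = 0" using Uk by (simp add: K_def cmp_def)
  have k_mono: "g = h" if "v \<in> obj C" "g \<in> hom C v w" "h \<in> hom C v w" "k \<cdot> g = k \<cdot> h" for v g h
  proof -
    have "mor U \<cdot> (k \<cdot> g) = (mor U \<cdot> k) \<cdot> g"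
      using that k_hom \<open>mor U \<in> hom C b b\<close> by (intro comp_assoc[symmetric, of v w b b]) auto
    also have "\<dots> = 0 \<cdot> g" by (simp add: Uk)
    also have "\<dots> = 0"
      using comp_smult_left[of v w b g k 0] that k_hom by simp
    finally show ?thesis
      using k_uniq[of v "k \<cdot> g"] comp_hom[of v w b g k] that k_hom by auto
  qed
  interpret CK: central_endo_kernel C b e U K
  proof
    fix x assume x [simp]: "x \<in> obj C"
    show "x \<rhd> U \<odot> E x = E x \<odot> U \<lhd> x"
      using T_central[OF x] by (simp add: U_def)
  next
    fix G assume G: "arr G" "tgt G = b" "mor (U \<odot> G) = 0"
    then have "src G \<in> obj C" "mor G \<in> hom C (src G) b" "mor U \<cdot> mor G = 0"
      unfolding arr_def by (auto simp: cmp_def)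
    then obtain l where "l \<in> hom C (src G) w" "k \<cdot> l = mor G" using k_uniq by blast
    then show "\<exists>H. arr H \<and> src H = src G \<and> tgt H = src K \<and> K \<odot> H = G"
      using \<open>src G \<in> obj C\<close> G(2)
      by (intro exI[of _ "Arrow (src G) l w"]) (auto simp: arr_Arrow cmp_def K_def intro: arrow.expand)
  next
    fix H H' assume H: "arr H" "arr H'" "src H = src H'" "tgt H = src K" "tgt H' = src K" "K \<odot> H = K \<odot> H'"
    then have "src H' \<in> obj C" "mor H \<in> hom C (src H') w" "mor H' \<in> hom C (src H') w" "k \<cdot> mor H = k \<cdot> mor H'"
      unfolding arr_def by (auto simp: cmp_def K_def)
    then have "mor H = mor H'" by (rule k_mono)
    then show "H = H'" using H by (intro arrow.expand) simp
  qed (use UK in simp_all)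
  let ?w = "(w, \<lambda>x. mor (CK.E' x))"
  have w_center: "?w \<in> obj (center C)"
    using CK.half_braiding_kernel by (simp add: center_def)
  have hom_center: "hom (center C) (x, d) (y, d') \<subseteq> hom C x y" for x y d d'
    by (auto simp: center_def)
  have k_center: "k \<in> hom (center C) ?w (b, e)"
    using CK.kernel_hom_center by (simp add: K_def)
  \<comment> \<open>Homs of the center are subsets of those of \<open>C\<close> with the same
    composition, so \<open>k\<close> stays mono.\<close>
  have "is_mono (center C) ?w (b, e) k"
    unfolding is_mono_def
  proof (intro conjI ballI impI k_center)
    fix z g h assume z: "z \<in> obj (center C)" "g \<in> hom (center C) z ?w" "h \<in> hom (center C) z ?w"
      and eq: "k \<cdot>\<^bsub>center C\<^esub> g = k \<cdot>\<^bsub>center C\<^esub> h"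
    obtain v d where "z = (v, d)" by (cases z)
    then show "g = h"
      using z eq hom_center k_mono[of v g h] by (auto simp: center_def)
  qed
  then have "k = 0 \<or> is_iso (center C) ?w (b, e) k"
    using simple w_center unfolding simple_obj_def by blast
  \<comment> \<open>The eigenvector \<open>h\<close> is killed by \<open>mor U\<close>, hence
    factors through \<open>k\<close>; if \<open>k\<close> were 0, so would be
    \<open>h\<close>.\<close>
  moreover have "k \<noteq> 0"
  proof
    assume k0: "k = 0"
    have "mor U \<cdot> h = 0"
      unfolding U_def using h T_hom comp_add_left[of b b b h "mor T" "smult C (- c) (\<i>\<d> b)"]
        comp_smult_left[of b b b h "\<i>\<d> b" "- c"] ident_left[of b b h] ident_hom[of b]
        subspace_scale[OF V.subspace_V, of "\<i>\<d> b" "- c"]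
      by (simp add: idn_def)
    then obtain l where l: "l \<in> hom C b w" "k \<cdot> l = h" using k_uniq[of b h] h by auto
    then have "h = 0" using comp_smult_left[of b w b l k 0] k_hom k0 by simp
    then show False using h by simp
  qed
  \<comment> \<open>Being invertible in the center, \<open>k\<close> has a right inverse
    \<open>g\<close>, and \<open>mor U \<cdot> k = 0\<close> then forces
    \<open>mor U = 0\<close>.\<close>
  ultimately obtain g where g: "g \<in> hom C b w" "k \<cdot> g = \<i>\<d> b"
    using hom_center[of b e w] by (auto simp: is_iso_def center_def)
  have "mor U = mor U \<cdot> (k \<cdot> g)"
    using ident_right[of b b "mor U"] \<open>mor U \<in> hom C b b\<close> g by simp
  also have "\<dots> = (mor U \<cdot> k) \<cdot> g"
    using g k_hom \<open>mor U \<in> hom C b b\<close> by (intro comp_assoc[symmetric, of b w b b]) auto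
  also have "\<dots> = 0" using comp_smult_left[of b w b g k 0] k_hom g by (simp add: Uk)
  finally show ?thesis using mor_U by (intro exI[of _ c]) simp
qed

section \<open>Eigenvalues and multiplicities of the rotation operator\<close>

theorem proposition3p4:
  fixes C :: "('o, 'm::ab_group_add) piv_cat"
    and a :: 'o and b :: "'o \<times> ('o \<Rightarrow> 'm)" and n :: nat
  assumes "spherical_fusion_category C"
    and "a \<in> obj C"
    and "b \<in> obj (center C)" and "simple_obj (center C) b"
    and "n \<ge> 1"
  shows "(\<forall>\<omega>. eigenvalue_on (smult C) (rot_space C b n a) (rot C b n a) \<omega>
              \<longrightarrow> \<omega> ^ n = inverse (twist_scalar C b)) \<and>
         (\<forall>\<omega>. \<omega> ^ n = inverse (twist_scalar C b) \<longrightarrow>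
              of_nat (alg_mult (smult C) (rot_space C b n a) (rot C b n a) \<omega>)
                = FS_poly C b n a (inverse \<omega>) \<and>
              of_nat (geom_mult (smult C) (rot_space C b n a) (rot C b n a) \<omega>)
                = FS_poly C b n a (inverse \<omega>))"
proof -
  obtain b0 e where b: "b = (b0, e)" by (cases b)
  interpret C: spherical_fusion_category C by (rule assms(1))
  interpret H: half_braided_object C b0 e
    using assms(3) by unfold_locales (auto simp: b center_def)
  note a = assms(2)
  let ?V = "hom C b0 (tens_pow C a n)" and ?T = "rot C (b0, e) n a"
  interpret V: finite_dim_subspace "smult C" ?V
    using C.hom_finite_dim[of b0 "tens_pow C a n"] a by unfold_locales simp
  \<comment> \<open>By \<open>TW_central\<close> the twist is an endomorphism in the center, so
    Schur's lemma makes it a scalar.\<close>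
  have "\<exists>c. mor H.TW = smult C c (ident C b0)"
  proof (rule H.central_endo_scalar)
    show "\<exists>w\<in>obj C. \<exists>k. is_kernel C w b0 b0 k f" if "f \<in> hom C b0 b0" for f
      using that by (intro C.kernels) auto
    show "\<exists>B. finite B \<and> hom C b0 b0 = C.span B" by (intro C.hom_finite_dim) auto
    show "simple_obj (center C) (b0, e)" using assms(4) b by simp
  qed (simp_all add: H.TW_central)
  then obtain c where c: "twist C (b0, e) = smult C c (ident C b0)" by (auto simp: H.mor_TW)
  have id_nz: "ident C b0 \<noteq> 0" using assms(4) by (simp add: b simple_obj_def center_def)
  \<comment> \<open>A nonzero identity makes the scalar unique, as the definite description
    demands.\<close>
  then have tw: "twist_scalar C b = c"
    unfolding twist_scalar_def using c by (intro the_equality) (auto simp: b)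
  have c_nz: "c \<noteq> 0" using H.twist_nonzero[OF id_nz] c by auto
  have endo: "V.endo ?T"
    using H.rot_linear[OF a] H.rot_in[OF a] assms(5) unfolding V.endo_def by auto
  have Tn: "(?T ^^ n) f = smult C (inverse c) f" if f: "f \<in> ?V" for f
  proof -
    have "smult C c ((?T ^^ n) f) = f"
      using H.rot_funpow_twist[OF a f c] V.endo_funpow[OF endo, of n] f by (simp add: V.endo_def)
    then have "smult C (inverse c) (smult C c ((?T ^^ n) f)) = smult C (inverse c) f" by simp
    then show ?thesis using c_nz by simp
  qed
  have "\<omega> ^ n = inverse c" if v: "v \<in> ?V" "v \<noteq> 0" "?T v = smult C \<omega> v" for \<omega> v
  proof -
    have "(?T ^^ k) v = smult C (\<omega> ^ k) v" for k
    proof (induction k)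
      case (Suc k)
      then show ?case using v endo by (simp add: V.endo_def mult.commute)
    qed simp
    then show ?thesis using Tn[OF v(1)] v(2) by simp
  qed
  \<comment> \<open>All exponents in \<open>FS_poly\<close> are nonnegative, so
    \<open>rot_power\<close> is an ordinary power and the indicators are the traces in
    \<open>finite_order_multiplicities\<close>.\<close>
  moreover have "of_nat (geom_mult (smult C) ?V ?T \<omega>) = FS_poly C b n a (inverse \<omega>)
      \<and> alg_mult (smult C) ?V ?T \<omega> = geom_mult (smult C) ?V ?T \<omega>" if \<omega>: "\<omega> ^ n = inverse c" for \<omega>
  proof -
    \<comment> \<open>As \<open>n \<ge> 1\<close>, a zero \<open>\<omega>\<close> would give
      \<open>inverse c = 0\<close>.\<close>
    have "\<omega> \<noteq> 0" using \<omega> c_nz assms(5) by (auto simp: power_0_left)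
    then show ?thesis
      using V.finite_order_multiplicities[OF endo, of n \<omega>] Tn \<omega> assms(5)
      by (simp add: FS_poly_def FS_indicator_def rot_power_def b)
  qed
  ultimately show ?thesis unfolding tw eigenvalue_on_def by (auto simp: b)
qed

end
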